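(* There exist a kernel $K\in C(\mathbb{R}^3;\mathbb{R}^{3\times3})$, a time $T>0$, and a time-dependent locally finite $\mathbb{R}^3$-valued Borel measure $\omega=\omega(t)$, $t\in[0,T]$, on $\mathbb{R}^3$ whose distributional divergence $\nabla\cdot\omega(t)$ is a locally finite signed Borel measure for each $t$, such that the velocity $$u(t,x)\coloneqq\int_{\mathbb{R}^3}K(x-y)\,d\omega(t)(y)$$ is continuous and weakly divergence free, $\omega$ is weakly advected by $u$ on $[0,T]$ in the sense of the vector weak advection definition below, $\dim_H\mathrm{supp}\,\omega(0)=1$, and $\dim_H\mathrm{supp}\,\omega(T)=2$.
   Context: Vector weak advection with stretching: Let $T>0$ and $u:[0,T]\times\mathbb{R}^3\to\mathbb{R}^3$ be continuous. A family $\omega(t)$, $t\in[0,T]$, of locally finite $\mathbb{R}^3$-valued Borel measures with locally finite distributional divergence $\nabla\cdot\omega(t)$ (defined by $\langle\varphi,\nabla\cdot\omega(t)\rangle=-\int\nabla\varphi\cdot d\omega(t)$) is weakly advected by $u$ on $[0,T]$ if for all $\phi\in C_c^\infty([0,T]\times\mathbb{R}^3;\mathbb{R}^3)$ $$\int_0^T\!\!\int\partial_t\phi\cdot d\omega(t)\,dt-\int\phi(T,\cdot)\cdot d\omega(T)+\int\phi(0,\cdot)\cdot d\omega(0)+\int_0^T\!\!\int((u\cdot\nabla)\phi)\cdot d\omega(t)\,dt-\int_0^T\!\!\int((\nabla\phi)^\top u)\cdot d\omega(t)\,dt-\int_0^T\langle\phi(t,\cdot)\cdot u(t,\cdot),\nabla\cdot\omega(t)\rangle\,dt=0.$$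 Here $(\nabla\phi)^\top u$ denotes the vector with components $\sum_j \partial_i\phi_j\,u_j$. $\dim_H$ denotes Hausdorff dimension. *)

theory Defs
  imports "HOL-Analysis.Analysis"
begin

type_synonym R3 = "real ^ 3"

fun C_k :: "nat \<Rightarrow> ('a::euclidean_space \<Rightarrow> 'b::real_normed_vector) \<Rightarrow> bool" where
  "C_k 0 f = continuous_on UNIV f"
| "C_k (Suc n) f = ((\<forall>x. f differentiable (at x)) \<and>
                    (\<forall>v. C_k n (\<lambda>x. frechet_derivative f (at x) v)))"

definition smooth :: "('a::euclidean_space \<Rightarrow> 'b::real_normed_vector) \<Rightarrow> bool" where
  "smooth f \<longleftrightarrow> (\<forall>n. C_k n f)"

definition test_fun :: "('a::euclidean_space \<Rightarrow> 'b::real_normed_vector) \<Rightarrow> bool" where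
  "test_fun f \<longleftrightarrow> smooth f \<and> compact (closure {x. f x \<noteq> 0})"

definition pderiv_dir :: "('a::real_normed_vector \<Rightarrow> 'b::real_normed_vector) \<Rightarrow> 'a \<Rightarrow> 'a \<Rightarrow> 'b" where
  "pderiv_dir f z v = frechet_derivative f (at z) v"

definition grad3 :: "(R3 \<Rightarrow> real) \<Rightarrow> R3 \<Rightarrow> R3" where
  "grad3 f x = (\<chi> i. pderiv_dir f x (axis i 1))"

definition loc_finite_borel :: "R3 measure \<Rightarrow> bool" where
  "loc_finite_borel M \<longleftrightarrow> sets M = sets borel \<and> (\<forall>C. compact C \<longrightarrow> emeasure M C < \<infinity>)"

text \<open>A locally finite R^3-valued Borel measure is represented in polar form
  \<open>\<omega> = g \<mu>\<close>: \<open>\<mu>\<close> = total variation measure (locally finite, positive, Borel)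
  and \<open>g\<close> a Borel unit vector field.  Thus \<open>\<integral>\<phi>\<cdot>d\<omega> = \<integral>\<phi>\<cdot>g d\<mu>\<close>.\<close>
definition vec_measure :: "R3 measure \<Rightarrow> (R3 \<Rightarrow> R3) \<Rightarrow> bool" where
  "vec_measure \<mu> g \<longleftrightarrow> loc_finite_borel \<mu> \<and> g \<in> borel_measurable borel \<and> (\<forall>x. norm (g x) = 1)"

definition vint :: "R3 measure \<Rightarrow> (R3 \<Rightarrow> R3) \<Rightarrow> (R3 \<Rightarrow> R3) \<Rightarrow> real" where
  "vint \<mu> g \<phi> = (\<integral>y. \<phi> y \<bullet> g y \<partial>\<mu>)"

text \<open>A locally finite signed Borel measure is represented as a difference
  \<open>\<nu>\<^sup>+ - \<nu>\<^sup>-\<close> of locally finite positive Borel measures.\<close>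
definition sint :: "R3 measure \<Rightarrow> R3 measure \<Rightarrow> (R3 \<Rightarrow> real) \<Rightarrow> real" where
  "sint np nm f = (\<integral>y. f y \<partial>np) - (\<integral>y. f y \<partial>nm)"

definition is_divergence :: "R3 measure \<Rightarrow> (R3 \<Rightarrow> R3) \<Rightarrow> R3 measure \<Rightarrow> R3 measure \<Rightarrow> bool" where
  "is_divergence \<mu> g np nm \<longleftrightarrow> loc_finite_borel np \<and> loc_finite_borel nm \<and>
     (\<forall>\<psi>::R3 \<Rightarrow> real. test_fun \<psi> \<longrightarrow> sint np nm \<psi> = - vint \<mu> g (grad3 \<psi>))"

text \<open>Support of the vector measure \<open>g \<mu>\<close> (= support of its total variation \<mu>).\<close>
definition msupp :: "R3 measure \<Rightarrow> R3 set" where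
  "msupp \<mu> = {x. \<forall>e>0. emeasure \<mu> (ball x e) \<noteq> 0}"

definition velocity :: "(R3 \<Rightarrow> real^3^3) \<Rightarrow> (real \<Rightarrow> R3 measure) \<Rightarrow> (real \<Rightarrow> R3 \<Rightarrow> R3) \<Rightarrow> real \<Rightarrow> R3 \<Rightarrow> R3" where
  "velocity K \<mu> g t x = (\<integral>y. K (x - y) *v g t y \<partial>\<mu> t)"

definition weakly_div_free :: "(R3 \<Rightarrow> R3) \<Rightarrow> bool" where
  "weakly_div_free v \<longleftrightarrow> (\<forall>\<psi>::R3 \<Rightarrow> real. test_fun \<psi> \<longrightarrow>
      integrable lborel (\<lambda>x. grad3 \<psi> x \<bullet> v x) \<and> (\<integral>x. grad3 \<psi> x \<bullet> v x \<partial>lborel) = 0)"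

text \<open>Weak advection of \<open>\<omega>(t) = g t \<mu> t\<close> (with divergence \<open>np t - nm t\<close>) by u on [0,T].
  Test functions \<open>\<phi> \<in> C_c^\<infinity>([0,T]\<times>R^3;R^3)\<close> are represented by (restrictions of)
  compactly supported smooth functions on \<open>R \<times> R^3\<close>.  The time integrands are
  required to be Lebesgue integrable on [0,T].\<close>
definition weakly_advected ::
  "real \<Rightarrow> (real \<Rightarrow> R3 \<Rightarrow> R3) \<Rightarrow> (real \<Rightarrow> R3 measure) \<Rightarrow> (real \<Rightarrow> R3 \<Rightarrow> R3)
     \<Rightarrow> (real \<Rightarrow> R3 measure) \<Rightarrow> (real \<Rightarrow> R3 measure) \<Rightarrow> bool" where
  "weakly_advected T u \<mu> g np nm \<longleftrightarrow>
    (\<forall>\<phi>::real \<times> R3 \<Rightarrow> R3. test_fun \<phi> \<longrightarrow>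
      (let
         dt = (\<lambda>t y. pderiv_dir \<phi> (t, y) (1, 0));
         dx = (\<lambda>t y (v::R3). pderiv_dir \<phi> (t, y) (0, v));
         A = (\<lambda>t. vint (\<mu> t) (g t) (dt t));
         B = (\<lambda>t. vint (\<mu> t) (g t) (\<lambda>y. dx t y (u t y)));
         C = (\<lambda>t. vint (\<mu> t) (g t) (\<lambda>y. \<chi> i. dx t y (axis i 1) \<bullet> u t y));
         D = (\<lambda>t. sint (np t) (nm t) (\<lambda>y. \<phi> (t, y) \<bullet> u t y))
       in set_integrable lborel {0..T} A \<and> set_integrable lborel {0..T} B \<and>
          set_integrable lborel {0..T} C \<and> set_integrable lborel {0..T} D \<and>
          (LINT t:{0..T}|lborel. A t)
          - vint (\<mu> T) (g T) (\<lambda>y. \<phi> (T, y))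
          + vint (\<mu> 0) (g 0) (\<lambda>y. \<phi> (0, y))
          + (LINT t:{0..T}|lborel. B t)
          - (LINT t:{0..T}|lborel. C t)
          - (LINT t:{0..T}|lborel. D t) = 0))"

definition hausdorff_pre :: "real \<Rightarrow> real \<Rightarrow> 'a::metric_space set \<Rightarrow> ennreal" where
  "hausdorff_pre s \<delta> A = (INF C \<in> {C :: nat \<Rightarrow> 'a set. A \<subseteq> (\<Union>i. C i) \<and>
        (\<forall>i. bounded (C i) \<and> diameter (C i) \<le> \<delta>)}. (\<Sum>i. ennreal (diameter (C i) powr s)))"

definition hausdorff_measure :: "real \<Rightarrow> 'a::metric_space set \<Rightarrow> ennreal" where
  "hausdorff_measure s A = (SUP \<delta> \<in> {0<..}. hausdorff_pre s \<delta> A)"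

definition hausdorff_dim :: "'a::metric_space set \<Rightarrow> real" where
  "hausdorff_dim A = Inf {s. 0 \<le> s \<and> hausdorff_measure s A = 0}"

end

theory Submission
  imports Defs
begin

text \<open>
  Everything is invariant along the \<open>y\<close>-axis: \<open>\<omega>(t)\<close> consists of lines parallel to that axis, oriented
  by its unit vector, so its divergence vanishes, the stretching term integrates to zero along each
  line, and weak advection reduces to transport of the points where the lines meet the
  \<open>(x, z)\<close>-plane. The velocity is a sum of two shears \<open>(f(z), 0, f(x))\<close>, hence divergence free for any
  continuous \<open>f\<close>. With \<open>f(s) = 2 \<surd>s\<close> near \<open>0\<close>, the points \<open>(s, s)\<close> move by \<open>s' = 2 \<surd>s\<close>, which is
  non-unique at \<open>0\<close>: each line initially at the origin may leave at a time \<open>\<tau>\<close> of its own,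
  following \<open>s = (t - \<tau>)\<^sup>2\<close>. Letting \<open>\<tau>\<close> be uniform on \<open>[0, 1]\<close> spreads a single line into a strip.
  The field \<open>f\<close> is generated by another, immobile line through \<open>(3, 3)\<close>: the kernel vanishes at
  all differences of positions except those from the immobile line to the moving ones.
\<close>

section \<open>Hausdorff measure and dimension\<close>

lemma hausdorff_measure_eq_0I:
  assumes "\<And>\<delta> \<epsilon>. 0 < \<delta> \<Longrightarrow> 0 < \<epsilon> \<Longrightarrow> hausdorff_pre s \<delta> A \<le> ennreal \<epsilon>"
  shows "hausdorff_measure s A = 0"
proof -
  have "hausdorff_pre s \<delta> A = 0" if "0 < \<delta>" for \<delta>
  proof -
    have "hausdorff_pre s \<delta> A \<le> 0"
      by (rule ennreal_le_epsilon) (use assms[OF that] in auto)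
    then show ?thesis by simp
  qed
  then show ?thesis
    unfolding hausdorff_measure_def by (auto intro!: antisym SUP_least)
qed

lemma hausdorff_pre_le_suminf:
  assumes "A \<subseteq> (\<Union>i. C i)" "\<And>i. bounded (C i)" "\<And>i. diameter (C i) \<le> \<delta>"
  shows "hausdorff_pre s \<delta> A \<le> (\<Sum>i. ennreal (diameter (C i) powr s))"
  unfolding hausdorff_pre_def by (rule INF_lower) (use assms in auto)

text \<open>Each \<open>A i\<close> has a cover costing less than
  \<open>\<epsilon> / 2 ^ (i + 1)\<close>, and these covers together cost at most
  \<open>\<epsilon>\<close>. Allowing any subset \<open>B\<close> of the union builds in
  monotonicity.\<close>

lemma hausdorff_measure_countable_Union_eq_0:
  assumes "\<And>i::nat. hausdorff_measure s (A i) = 0" "B \<subseteq> (\<Union>i. A i)"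
  shows "hausdorff_measure s B = 0"
proof (rule hausdorff_measure_eq_0I)
  fix \<delta> \<epsilon> :: real assume \<delta>: "0 < \<delta>" and \<epsilon>: "0 < \<epsilon>"
  have "\<exists>C. A i \<subseteq> (\<Union>j::nat. C j) \<and> (\<forall>j. bounded (C j) \<and> diameter (C j) \<le> \<delta>) \<and>
      (\<Sum>j. ennreal (diameter (C j) powr s)) < ennreal (\<epsilon> * (1/2)^Suc i)" for i
  proof -
    have "hausdorff_pre s \<delta> (A i) \<le> hausdorff_measure s (A i)"
      unfolding hausdorff_measure_def by (rule SUP_upper) (use \<delta> in auto)
    then have "hausdorff_pre s \<delta> (A i) < ennreal (\<epsilon> * (1/2)^Suc i)"
      using assms(1)[of i] \<epsilon> by simp
    then show ?thesis
      unfolding hausdorff_pre_def INF_less_iff by auto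
  qed
  then obtain C where C: "\<And>i. A i \<subseteq> (\<Union>j::nat. C i j)" "\<And>i j. bounded (C i j)"
    "\<And>i j. diameter (C i j) \<le> \<delta>"
    "\<And>i. (\<Sum>j. ennreal (diameter (C i j) powr s)) < ennreal (\<epsilon> * (1/2)^Suc i)"
    by metis
  define D where "D n = (case prod_decode n of (i, j) \<Rightarrow> C i j)" for n
  have "B \<subseteq> (\<Union>n. D n)"
  proof
    fix x assume "x \<in> B"
    then obtain i j where "x \<in> C i j" using assms(2) C(1) by blast
    then have "x \<in> D (prod_encode (i, j))" by (simp add: D_def)
    then show "x \<in> (\<Union>n. D n)" by blast
  qed
  then have "hausdorff_pre s \<delta> B \<le> (\<Sum>n. ennreal (diameter (D n) powr s))"
    by (rule hausdorff_pre_le_suminf) (auto simp: D_def C split: prod.split)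
  also have "\<dots> = (\<Sum>n. (case prod_decode n of (i, j) \<Rightarrow> ennreal (diameter (C i j) powr s)))"
    by (intro suminf_cong) (auto simp: D_def split: prod.split)
  also have "\<dots> = (\<Sum>i. \<Sum>j. ennreal (diameter (C i j) powr s))"
    by (rule suminf_ennreal_2dimen) simp
  also have "\<dots> \<le> (\<Sum>i. ennreal (\<epsilon> * (1/2)^Suc i))"
    by (intro suminf_le) (use C(4) in \<open>auto intro: less_imp_le\<close>)
  also have "\<dots> = ennreal \<epsilon>"
    using sums_mult[OF power_half_series, of \<epsilon>] \<epsilon>
    by (intro suminf_ennreal_eq) auto
  finally show "hausdorff_pre s \<delta> B \<le> ennreal \<epsilon>" .
qed

text \<open>\<open>N ^ n\<close> sets of diameter at most \<open>c / N\<close> cost at most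
  \<open>c powr s * N powr (n - s)\<close>, which tends to 0 as \<open>N\<close> grows because
  \<open>n < s\<close>. It serves for segments with \<open>n = 1\<close> and for squares with
  \<open>n = 2\<close>.\<close>

lemma hausdorff_measure_eq_0_of_covers:
  fixes A :: "'a::metric_space set" and C :: "nat \<Rightarrow> nat \<Rightarrow> 'a set"
  assumes cov: "\<And>N. 0 < N \<Longrightarrow> A \<subseteq> (\<Union>i<N ^ n. C N i)"
    and bd: "\<And>N i. bounded (C N i)"
    and diam: "\<And>N i. diameter (C N i) \<le> c / real N" and s: "real n < s"
  shows "hausdorff_measure s A = 0"
proof (rule hausdorff_measure_eq_0I)
  fix \<delta> \<epsilon> :: real assume \<delta>: "0 < \<delta>" and \<epsilon>: "0 < \<epsilon>"
  have "0 \<le> c" using diam[of 1 0] diameter_ge_0[OF bd, of 1 0] by simp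
  have "((\<lambda>N. c powr s * real N powr (real n - s)) \<longlongrightarrow> c powr s * 0) sequentially"
    by (intro tendsto_intros tendsto_neg_powr filterlim_real_sequentially) (use s in auto)
  then have 1: "\<forall>\<^sub>F N in sequentially. c powr s * real N powr (real n - s) < \<epsilon>"
    using \<epsilon> by (auto dest: order_tendstoD)
  have "((\<lambda>N. c / real N) \<longlongrightarrow> 0) sequentially"
    by (rule lim_const_over_n)
  then have 2: "\<forall>\<^sub>F N in sequentially. c / real N < \<delta>"
    using \<delta> by (auto dest: order_tendstoD)
  obtain N where N: "0 < N" "c / real N < \<delta>" "c powr s * real N powr (real n - s) < \<epsilon>"
    using eventually_happens'[OF _ eventually_conj[OF eventually_gt_at_top[of 0] eventually_conj[OF 1 2]]]
    by auto
  \<comment> \<open>Padding with empty sets is free: their diameter is 0 and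
    \<open>0 powr s = 0\<close>.\<close>
  define D where "D i = (if i < N ^ n then C N i else {})" for i
  have "A \<subseteq> (\<Union>i. D i)" using cov[OF N(1)] by (force simp: D_def)
  then have "hausdorff_pre s \<delta> A \<le> (\<Sum>i. ennreal (diameter (D i) powr s))"
    by (rule hausdorff_pre_le_suminf)
      (use bd order_trans[OF diam less_imp_le[OF N(2)]] \<delta> in \<open>auto simp: D_def\<close>)
  also have "\<dots> = (\<Sum>i<N ^ n. ennreal (diameter (D i) powr s))"
    by (rule suminf_finite) (auto simp: D_def)
  also have "\<dots> \<le> (\<Sum>i<N ^ n. ennreal ((c / real N) powr s))"
    using s diam bd
    by (intro sum_mono ennreal_leI powr_mono2) (auto simp: D_def diameter_ge_0)
  also have "\<dots> = ennreal (real (N ^ n) * (c / real N) powr s)"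
    by (simp add: ennreal_mult ennreal_of_nat_eq_real_of_nat del: of_nat_power)
  also have "real (N ^ n) * (c / real N) powr s = c powr s * real N powr (real n - s)"
    using N(1) \<open>0 \<le> c\<close> by (simp add: powr_divide powr_diff powr_realpow)
  also have "ennreal \<dots> \<le> ennreal \<epsilon>" using N(3) by (simp add: ennreal_leI)
  finally show "hausdorff_pre s \<delta> A \<le> ennreal \<epsilon>" .
qed

text \<open>Coverings by sets of diameter at most 1 satisfy \<open>d powr s \<ge> d ^ DIM('b)\<close>, also for \<open>d = 0\<close>
  with the convention \<open>0 powr 0 = 0\<close>.\<close>
lemma hausdorff_measure_neq_0:
  fixes f :: "'a::metric_space \<Rightarrow> 'b::euclidean_space"
  assumes f: "\<And>x y. dist (f x) (f y) \<le> dist x y" and A: "box 0 One \<subseteq> f ` A"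
    and s: "0 \<le> s" "s \<le> real DIM('b)"
  shows "hausdorff_measure s A \<noteq> 0"
proof -
  let ?n = "DIM('b)"
  \<comment> \<open>Volume comparison: the image of \<open>C i\<close> fits in a cube
    \<open>Q i\<close> of side \<open>2 * d i\<close>, hence of volume at most
    \<open>2 ^ ?n * d i powr s\<close>, and these cubes cover the unit box, of volume 1.\<close>
  have *: "ennreal 1 \<le> 2 ^ ?n * (\<Sum>i. ennreal (diameter (C i) powr s))"
    if C: "A \<subseteq> (\<Union>i::nat. C i)" "\<And>i. bounded (C i)" "\<And>i. diameter (C i) \<le> 1" for C
  proof -
    \<comment> \<open>If \<open>C i\<close> is empty then \<open>c i\<close> is arbitrary;
      \<open>Q i\<close> is then a single point and does no harm.\<close>
    define c where "c i = (SOME x. x \<in> C i)" for i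
    define d where "d i = diameter (C i)" for i
    define Q where "Q i = cbox (f (c i) - d i *\<^sub>R One) (f (c i) + d i *\<^sub>R One)" for i
    have d0: "0 \<le> d i" for i unfolding d_def by (rule diameter_ge_0[OF C(2)])
    have fQ: "f x \<in> Q i" if "x \<in> C i" for x i
    proof -
      have "c i \<in> C i" using that unfolding c_def by (rule someI)
      then have "dist (f x) (f (c i)) \<le> d i"
        using f[of x "c i"] diameter_bounded_bound[OF C(2) that] by (auto simp: d_def intro: order_trans)
      then have "\<bar>(f x - f (c i)) \<bullet> b\<bar> \<le> d i" if "b \<in> Basis" for b
        using Basis_le_norm[OF that, of "f x - f (c i)"] by (simp add: dist_norm)
      then show ?thesis
        by (auto simp: Q_def mem_box inner_diff_left inner_add_left abs_le_iff algebra_simps)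
    qed
    have "box 0 One \<subseteq> (\<Union>i. Q i)"
    proof
      fix y :: 'b assume "y \<in> box 0 One"
      then obtain x where "x \<in> A" "y = f x" using A by auto
      moreover obtain i where "x \<in> C i" using C(1) \<open>x \<in> A\<close> by auto
      ultimately show "y \<in> (\<Union>i. Q i)" using fQ[of x i] by auto
    qed
    then have "emeasure lborel (box 0 One :: 'b set) \<le> emeasure lborel (\<Union>i. Q i)"
      by (rule emeasure_mono) (auto simp: Q_def)
    also have "\<dots> \<le> (\<Sum>i. emeasure lborel (Q i))"
      by (rule emeasure_subadditive_countably) (auto simp: Q_def)
    also have "\<dots> \<le> (\<Sum>i. 2 ^ ?n * ennreal (d i powr s))"
    proof (rule suminf_le)
      fix i
      have "emeasure lborel (Q i) = ennreal ((2 * d i) ^ ?n)"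
        using d0[of i] by (simp add: Q_def emeasure_lborel_cbox_eq inner_diff_left inner_add_left algebra_simps)
      also have "d i ^ ?n \<le> d i powr s"
      proof (cases "d i = 0")
        case False
        then have "d i ^ ?n = d i powr real ?n" using d0[of i] by (simp add: powr_realpow)
        also have "\<dots> \<le> d i powr s" using False d0[of i] C(3)[of i] s
          by (intro powr_mono') (auto simp: d_def)
        finally show ?thesis .
      qed (simp add: zero_power)
      then have "ennreal ((2 * d i) ^ ?n) \<le> ennreal (2 ^ ?n * d i powr s)"
        by (intro ennreal_leI) (simp add: power_mult_distrib)
      also have "\<dots> = 2 ^ ?n * ennreal (d i powr s)"
        by (simp add: ennreal_mult ennreal_power[symmetric])
      finally show "emeasure lborel (Q i) \<le> 2 ^ ?n * ennreal (d i powr s)" .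
    qed auto
    finally show ?thesis by (simp add: d_def emeasure_lborel_box_eq)
  qed
  \<comment> \<open>A bound at scale 1 is enough, because \<open>hausdorff_measure\<close> is the
    supremum of \<open>hausdorff_pre\<close> over all scales.\<close>
  have "ennreal 1 / 2 ^ ?n \<le> hausdorff_pre s 1 A"
    unfolding hausdorff_pre_def
  proof (rule INF_greatest)
    fix C :: "nat \<Rightarrow> 'a set" assume "C \<in> {C. A \<subseteq> (\<Union>i. C i) \<and> (\<forall>i. bounded (C i) \<and> diameter (C i) \<le> 1)}"
    then have "ennreal 1 / 2 ^ ?n \<le> (2 ^ ?n * (\<Sum>i. ennreal (diameter (C i) powr s))) / 2 ^ ?n"
      by (intro divide_right_mono_ennreal *) auto
    also have "\<dots> = (\<Sum>i. ennreal (diameter (C i) powr s))"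
      by (subst mult.commute, rule mult_divide_eq_ennreal) (auto simp: power_eq_top_ennreal)
    finally show "ennreal 1 / 2 ^ ?n \<le> (\<Sum>i. ennreal (diameter (C i) powr s))" .
  qed
  also have "\<dots> \<le> hausdorff_measure s A"
    unfolding hausdorff_measure_def by (rule SUP_upper) auto
  finally show ?thesis by (auto simp: ennreal_divide_eq_0_iff power_eq_top_ennreal)
qed

lemma hausdorff_dim_eqI:
  assumes "\<And>s. d < s \<Longrightarrow> hausdorff_measure s A = 0"
    and "\<And>s. 0 \<le> s \<Longrightarrow> s < d \<Longrightarrow> hausdorff_measure s A \<noteq> 0" and "0 \<le> d"
  shows "hausdorff_dim A = d"
  unfolding hausdorff_dim_def
proof (rule antisym)
  have bdd: "bdd_below {s. 0 \<le> s \<and> hausdorff_measure s A = 0}" by (rule bdd_belowI[of _ 0]) auto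
  show "Inf {s. 0 \<le> s \<and> hausdorff_measure s A = 0} \<le> d"
    by (rule field_le_epsilon, rule cInf_lower[OF _ bdd]) (use assms in auto)
  show "d \<le> Inf {s. 0 \<le> s \<and> hausdorff_measure s A = 0}"
  proof (rule cInf_greatest)
    show "{s. 0 \<le> s \<and> hausdorff_measure s A = 0} \<noteq> {}"
      using assms(1)[of "d + 1"] assms(3) by (auto intro!: exI[of _ "d + 1"])
  qed (use assms(2) in force)
qed

section \<open>Directional derivatives integrate to zero\<close>

lemma continuous_zero_outside_bounded:
  fixes f :: "'a::heine_borel \<Rightarrow> 'b::real_normed_vector"
  assumes "continuous_on UNIV f" "bounded S" "\<And>x. x \<notin> S \<Longrightarrow> f x = 0"
  obtains B where "\<And>x. norm (f x) \<le> B"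
proof -
  have "compact (f ` closure S)"
    by (intro compact_continuous_image continuous_on_subset[OF assms(1)]) (use assms(2) in auto)
  then obtain B where B: "\<And>y. y \<in> f ` closure S \<Longrightarrow> norm y \<le> B"
    using compact_imp_bounded bounded_iff by metis
  have "norm (f x) \<le> max B 0" for x
    using B assms(3) closure_subset[of S] by (cases "x \<in> S") (auto intro!: max.coboundedI1)
  then show thesis by (rule that)
qed

lemma integrable_lborel_bounded_support:
  fixes f :: "'a::euclidean_space \<Rightarrow> 'b::{banach, second_countable_topology}"
  assumes f: "f \<in> borel_measurable borel" and S: "bounded S"
    and "\<And>x. x \<notin> S \<Longrightarrow> f x = 0" and B: "\<And>x. norm (f x) \<le> B"
  shows "integrable lborel f"
proof -
  obtain a where a: "S \<subseteq> cbox (-a) a" using bounded_subset_cbox_symmetric[OF S] by blast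
  show ?thesis
  proof (rule integrableI_bounded_set[where A = "cbox (-a) a" and B = B])
    show "emeasure lborel (cbox (-a) a) < \<infinity>" using emeasure_lborel_cbox_finite by simp
  qed (use assms a in auto)
qed

text \<open>Average the integral of the derivative over the translates by \<open>h *\<^sub>R v\<close>, \<open>0 \<le> h \<le> 1\<close>; after
  integrating out \<open>h\<close> first, invariance of Lebesgue measure under translation by \<open>v\<close> gives zero.\<close>
lemma integral_directional_derivative_eq_0:
  fixes f D w :: "'a::euclidean_space \<Rightarrow> real"
  assumes deriv: "\<And>x h. ((\<lambda>h. f (x + h *\<^sub>R v)) has_real_derivative D (x + h *\<^sub>R v)) (at h)"
    and contf: "continuous_on UNIV f" and contD: "continuous_on UNIV D" and contw: "continuous_on UNIV w"
    and S: "bounded S" and f0: "\<And>x. x \<notin> S \<Longrightarrow> f x = 0" and D0: "\<And>x. x \<notin> S \<Longrightarrow> D x = 0"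
    and inv: "\<And>x h. w (x + h *\<^sub>R v) = w x"
  shows "(\<integral>x. w x * D x \<partial>lborel) = 0"
proof -
  define g where "g x = w x * D x" for x
  have contg: "continuous_on UNIV g" unfolding g_def by (intro continuous_intros contw contD)
  have g0: "g x = 0" if "x \<notin> S" for x using D0[OF that] by (simp add: g_def)
  obtain B where B: "\<And>x. norm (g x) \<le> B"
    using continuous_zero_outside_bounded[OF contg S g0] by blast
  obtain R where R: "\<And>x. x \<in> S \<Longrightarrow> norm x \<le> R" using S by (auto simp: bounded_iff)
  \<comment> \<open>\<open>F\<close> carries the shift \<open>h\<close> as an additional variable,
    so that one Fubini exchange relates translation in \<open>x\<close> to the derivative in
    \<open>h\<close>.\<close>
  define F :: "real \<Rightarrow> 'a \<Rightarrow> real" where "F h x = indicator {0..1} h * g (x + h *\<^sub>R v)" for h x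
  note [measurable] = borel_measurable_continuous_onI[OF contg] borel_measurable_continuous_onI[OF contf]
    borel_measurable_continuous_onI[OF contw]
  have 0: "0 \<le> B" using order_trans[OF norm_ge_zero B] .
  have int: "integrable (lborel \<Otimes>\<^sub>M lborel) (case_prod F)"
    unfolding lborel_prod
  proof (rule integrable_lborel_bounded_support)
    \<comment> \<open>A shift by \<open>h *\<^sub>R v\<close> with \<open>0 \<le> h \<le> 1\<close>
      moves the support by at most \<open>norm v\<close>.\<close>
    show "bounded ({0..1::real} \<times> cball (0::'a) (R + norm v))" by (intro bounded_Times) auto
    show "case_prod F p = 0" if "p \<notin> {0..1} \<times> cball (0::'a) (R + norm v)" for p
    proof (rule ccontr)
      assume "case_prod F p \<noteq> 0"
      then have *: "fst p \<in> {0..1}" "snd p + fst p *\<^sub>R v \<in> S"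
        using g0 by (auto simp: F_def indicator_def split: prod.splits if_splits)
      have "norm (snd p) \<le> norm (snd p + fst p *\<^sub>R v) + norm (fst p *\<^sub>R v)"
        by (metis add_diff_cancel norm_triangle_ineq4)
      also have "\<dots> \<le> R + norm v" using R[OF *(2)] *(1) by (auto intro!: add_mono mult_left_le_one_le)
      finally show False using that *(1) by (auto simp: mem_Times_iff)
    qed
    show "norm (case_prod F p) \<le> B" for p
      using B 0 by (auto simp: F_def indicator_def split: prod.splits)
    show "case_prod F \<in> borel_measurable borel"
      unfolding F_def borel_prod[symmetric] by measurable
  qed
  have shift: "(\<integral>x. u (x + c) \<partial>lborel) = integral\<^sup>L lborel u"
    if "u \<in> borel_measurable borel" for u :: "'a \<Rightarrow> real" and c
  proof -
    have "integral\<^sup>L (distr lborel borel ((+) c)) u = (\<integral>x. u (c + x) \<partial>lborel)"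
      by (rule integral_distr) (use that in auto)
    then show ?thesis by (simp add: lborel_distr_plus add.commute)
  qed
  have "integral\<^sup>L lborel g = (\<integral>h. indicator {0..1::real} h * integral\<^sup>L lborel g \<partial>lborel)"
    by simp
  also have "\<dots> = (\<integral>h. \<integral>x. F h x \<partial>lborel \<partial>lborel)"
    using shift[of g] by (simp add: F_def)
  also have "\<dots> = (\<integral>x. \<integral>h. F h x \<partial>lborel \<partial>lborel)"
    by (rule lborel_pair.Fubini_integral[OF int, symmetric])
  \<comment> \<open>By \<open>inv\<close> the weight is constant along \<open>v\<close> and leaves
    the integral over \<open>h\<close>, so that only a difference of boundary values of
    \<open>f\<close> remains.\<close>
  also have "(\<lambda>x. \<integral>h. F h x \<partial>lborel) = (\<lambda>x. w x * f (x + v) - w x * f x)"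
  proof
    fix x
    have "(\<integral>h. D (x + h *\<^sub>R v) * indicator {0..1} h \<partial>lborel) = f (x + 1 *\<^sub>R v) - f (x + 0 *\<^sub>R v)"
    proof (rule integral_FTC_Icc_real)
      show "isCont (\<lambda>h. D (x + h *\<^sub>R v)) h" for h
        using continuous_on_compose2[OF contD, of UNIV "\<lambda>h. x + h *\<^sub>R v"]
        by (auto simp: continuous_on_eq_continuous_at continuous_intros)
    qed (use deriv in auto)
    moreover have "F h x = w x * (D (x + h *\<^sub>R v) * indicator {0..1} h)" for h
      by (simp add: F_def g_def inv)
    ultimately show "(\<integral>h. F h x \<partial>lborel) = w x * f (x + v) - w x * f x"
      by (simp add: right_diff_distrib)
  qed
  also have "(\<integral>x. w x * f (x + v) - w x * f x \<partial>lborel) = 0"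
  proof -
    have contwf: "continuous_on UNIV (\<lambda>x. w x * f x)" by (intro continuous_intros contw contf)
    have wf0: "w x * f x = 0" if "x \<notin> S" for x using f0[OF that] by simp
    obtain B' where B': "\<And>x. norm (w x * f x) \<le> B'"
      using continuous_zero_outside_bounded[OF contwf S wf0] by blast
    have i: "integrable lborel (\<lambda>x. w x * f x)"
      by (rule integrable_lborel_bounded_support[OF _ S wf0 B']) simp
    have i': "integrable lborel (\<lambda>x. w (x + v) * f (x + v))"
    proof -
      have "integrable (distr lborel borel ((+) v)) (\<lambda>x. w x * f x)" using i by (simp add: lborel_distr_plus)
      then show ?thesis by (subst (asm) integrable_distr_eq) (auto simp: add.commute)
    qed
    have "w (x + v) = w x" for x using inv[of x 1] by simp
    with i i' shift[of "\<lambda>x. w x * f x" v] show ?thesis by simp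
  qed
  finally show ?thesis by (simp add: g_def)
qed

section \<open>Test functions\<close>

lemma test_fun_has_derivative:
  "test_fun f \<Longrightarrow> (f has_derivative frechet_derivative f (at x)) (at x)"
  by (auto simp: test_fun_def smooth_def frechet_derivative_works dest!: spec[of _ "Suc 0"])

lemma test_fun_continuous: "test_fun f \<Longrightarrow> continuous_on UNIV f"
  by (auto simp: test_fun_def smooth_def dest!: spec[of _ 0])

lemma test_fun_derivative_continuous:
  "test_fun f \<Longrightarrow> continuous_on UNIV (\<lambda>x. frechet_derivative f (at x) v)"
  by (auto simp: test_fun_def smooth_def dest!: spec[of _ "Suc 0"])

lemma test_fun_derivative_linear: "test_fun f \<Longrightarrow> linear (frechet_derivative f (at x))"
  by (rule has_derivative_linear[OF test_fun_has_derivative])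

lemma test_fun_derivative_compose:
  assumes "test_fun f" "(c has_vector_derivative c') (at h within S)"
  shows "((\<lambda>h. f (c h)) has_vector_derivative frechet_derivative f (at (c h)) c') (at h within S)"
  using vector_derivative_diff_chain_within[OF assms(2)
      has_derivative_at_withinI[OF test_fun_has_derivative[OF assms(1)]]]
  by (simp add: o_def)

text \<open>One radius serves the function and its derivative: off its closed support the function
  vanishes on an open neighbourhood, so the derivative is zero there too.\<close>

lemma test_fun_bounded_support:
  assumes "test_fun f"
  obtains R where "\<And>x. R < norm x \<Longrightarrow> f x = 0"
    and "\<And>x v. R < norm x \<Longrightarrow> frechet_derivative f (at x) v = 0"
proof -
  let ?S = "closure {x. f x \<noteq> 0}"
  have "bounded ?S" using assms unfolding test_fun_def by (intro compact_imp_bounded) simp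
  then obtain R where R: "\<And>x. x \<in> ?S \<Longrightarrow> norm x \<le> R" by (auto simp: bounded_iff)
  have f0: "f x = 0" if "x \<notin> ?S" for x using that subsetD[OF closure_subset, of x "{x. f x \<noteq> 0}"] by blast
  have D0: "frechet_derivative f (at x) v = 0" if "x \<notin> ?S" for x v
  proof -
    have "((\<lambda>x. 0) has_derivative (\<lambda>_. 0)) (at x)" by simp
    moreover have "open (- ?S)" by (rule open_Compl) (rule closed_closure)
    ultimately have "(f has_derivative (\<lambda>_. 0)) (at x)"
    proof (rule has_derivative_transform_within_open)
      show "x \<in> - ?S" using that by blast
      show "0 = f y" if "y \<in> - ?S" for y by (rule f0[symmetric]) (use that in blast)
    qed
    then have "frechet_derivative f (at x) = (\<lambda>_. 0)" by (rule frechet_derivative_at[symmetric])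
    then show ?thesis by simp
  qed
  have out: "x \<notin> ?S" if "R < norm x" for x using R[of x] that by linarith
  show thesis by (rule that[of R, OF f0[OF out] D0[OF out]])
qed

section \<open>The kernel and the measure\<close>

definition tent :: "real \<Rightarrow> real" where "tent r = max 0 (1 - \<bar>r\<bar>)"

text \<open>Supported on \<open>[-3, -1]\<close>, with value \<open>2 * sqrt s\<close> at
  \<open>s - 3\<close> for \<open>0 \<le> s \<le> 1\<close>: the influence of the line at 3 on a
  line at \<open>s\<close>. The differences that must give nothing, namely between two moving lines,
  from a moving line to the immobile one, or from a line to itself, are all at least -1.\<close>

definition alpha :: "real \<Rightarrow> real" where "alpha r = 2 * sqrt (tent (r + 2))"

text \<open>The factor 3/4 normalises the integral to 1, so that integrating the kernel along a line
  parallel to \<open>axis 2 1\<close> removes the second coordinate. The cutoff also makes that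
  integral converge.\<close>

definition bump :: "real \<Rightarrow> real" where "bump r = 3/4 * max 0 (1 - r\<^sup>2)"

definition dir :: R3 where "dir = axis 1 1 + axis 3 1"

definition point :: "real \<Rightarrow> real \<Rightarrow> R3" where "point s y = s *\<^sub>R dir + y *\<^sub>R axis 2 1"

text \<open>The first component does not depend on \<open>d $ 1\<close>, the third does not depend
  on \<open>d $ 3\<close>, and the second is zero, so superpositions of translates are formally
  divergence free.\<close>

definition kvec :: "R3 \<Rightarrow> R3" where
  "kvec d = bump (d $ 2) *\<^sub>R (alpha (d $ 3) *\<^sub>R axis 1 1 + alpha (d $ 1) *\<^sub>R axis 3 1)"

text \<open>The rank-one matrix \<open>kvec d\<close> times the transpose of
  \<open>axis 2 1\<close>; applied to the constant orientation \<open>axis 2 1\<close> of the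
  measure it returns \<open>kvec d\<close>.\<close>

definition kern :: "R3 \<Rightarrow> real^3^3" where "kern d = (\<chi> i j. kvec d $ i * axis 2 1 $ j)"

text \<open>Labels \<open>\<tau> \<in> [0, 1]\<close> are departure times; labels \<open>\<tau> \<in> (1, 2]\<close> all denote the immobile line.\<close>
definition X :: "real \<Rightarrow> real \<Rightarrow> real" where
  "X t \<tau> = (if \<tau> \<le> 1 then (max 0 (t - \<tau>))\<^sup>2 else 3)"

definition V :: "real \<Rightarrow> real \<Rightarrow> real" where
  "V t \<tau> = (if \<tau> \<le> 1 then 2 * max 0 (t - \<tau>) else 0)"

definition lines :: "real \<Rightarrow> real \<times> real \<Rightarrow> R3" where
  "lines t p = point (X t (fst p)) (snd p)"

abbreviation strip :: "(real \<times> real) set" where "strip \<equiv> {0..2} \<times> UNIV"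

text \<open>As a pushforward of Lebesgue measure on the labels, the measure has all its time
  dependence in \<open>lines t\<close>, and integrals at all times live on the same strip. The
  labels of the immobile line have length 1, so that line has density 1.\<close>

definition mu :: "real \<Rightarrow> R3 measure" where
  "mu t = distr (density lborel (\<lambda>p. ennreal (indicator strip p))) borel (lines t)"

text \<open>The shear profile left after the kernel has been integrated along each line; both
  nonzero velocity components are values of it.\<close>

definition U :: "real \<Rightarrow> real \<Rightarrow> real" where
  "U t r = (\<integral>\<tau>. indicator {0..2} \<tau> * alpha (r - X t \<tau>) \<partial>lborel)"

section \<open>Elementary facts about the profiles and the kernel\<close>

lemma point_nth [simp]: "point s y $ 1 = s" "point s y $ 2 = y" "point s y $ 3 = s"
  by (simp_all add: point_def dir_def axis_def)

lemma kern_mult: "kern d *v axis 2 1 = kvec d"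
  by (simp add: kern_def matrix_vector_mult_def vec_eq_iff axis_def sum_3)

lemma alpha_continuous: "continuous_on S f \<Longrightarrow> continuous_on S (\<lambda>x. alpha (f x))"
  unfolding alpha_def tent_def by (intro continuous_intros)

lemma bump_continuous: "continuous_on S f \<Longrightarrow> continuous_on S (\<lambda>x. bump (f x))"
  unfolding bump_def by (intro continuous_intros)

lemma alpha_measurable [measurable]: "alpha \<in> borel_measurable borel"
  by (intro borel_measurable_continuous_onI alpha_continuous continuous_intros)

lemma bump_measurable [measurable]: "bump \<in> borel_measurable borel"
  by (intro borel_measurable_continuous_onI bump_continuous continuous_intros)

lemma abs_alpha_le: "\<bar>alpha r\<bar> \<le> 2"
proof -
  have "sqrt (tent (r + 2)) \<le> 1" by (simp add: tent_def)
  moreover have "0 \<le> sqrt (tent (r + 2))" by (simp add: tent_def)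
  ultimately show ?thesis by (simp add: alpha_def)
qed

lemma alpha_eq_0: "-1 \<le> r \<Longrightarrow> alpha r = 0"
  by (simp add: alpha_def tent_def)

text \<open>Stated in \<open>r = sqrt s\<close> because the trajectories are squares: with
  \<open>r = t - \<tau>\<close> the position is \<open>r\<^sup>2\<close> and the speed is
  \<open>2 * r\<close>.\<close>

lemma alpha_square: "0 \<le> r \<Longrightarrow> r \<le> 1 \<Longrightarrow> alpha (r\<^sup>2 - 3) = 2 * r"
proof -
  assume r: "0 \<le> r" "r \<le> 1"
  then have "tent (r\<^sup>2 - 3 + 2) = r\<^sup>2"
    using power_le_one[of r 2] by (simp add: tent_def)
  then show ?thesis using r by (simp add: alpha_def)
qed

lemma bump_eq_0: "1 < \<bar>r\<bar> \<Longrightarrow> bump r = 0"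
  using power_mono[of 1 "\<bar>r\<bar>" 2] by (simp add: bump_def)

lemma abs_bump_le: "\<bar>bump r\<bar> \<le> 1"
  using zero_le_power2[of r] unfolding bump_def max_def
  by (simp add: abs_if field_simps)

lemma integral_bump: "(\<integral>y. bump (c - y) \<partial>lborel) = 1"
proof -
  \<comment> \<open>The antiderivative is \<open>3/4 * (y + (c - y)^3/3)\<close>.\<close>
  have "(\<integral>y. (3/4 * (1 - (c - y)\<^sup>2)) * indicator {c-1..c+1} y \<partial>lborel)
      = 3/4 * ((c+1) + (c - (c+1))^3/3) - 3/4 * ((c-1) + (c - (c-1))^3/3)"
    by (rule integral_FTC_Icc_real)
      (auto intro!: derivative_eq_intros simp: field_simps power2_eq_square power3_eq_cube)
  also have "\<dots> = 1" by (simp add: power3_eq_cube field_simps)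
  finally have *: "(\<integral>y. (3/4 * (1 - (c - y)\<^sup>2)) * indicator {c-1..c+1} y \<partial>lborel) = 1" .
  have "(\<lambda>y. (3/4 * (1 - (c - y)\<^sup>2)) * indicator {c-1..c+1} y) = (\<lambda>y. bump (c - y))"
  proof
    fix y show "(3/4 * (1 - (c - y)\<^sup>2)) * indicator {c-1..c+1} y = bump (c - y)"
    proof (cases "\<bar>c - y\<bar> \<le> 1")
      case True
      then have "(c - y)\<^sup>2 \<le> 1" by (simp add: abs_square_le_1)
      then show ?thesis using True by (auto simp: bump_def indicator_def abs_le_iff)
    next
      case False
      then show ?thesis using bump_eq_0[of "c - y"] by (auto simp: indicator_def abs_le_iff)
    qed
  qed
  with * show ?thesis by metis
qed

lemma kvec_continuous: "continuous_on UNIV kvec"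
  unfolding kvec_def by (intro continuous_intros alpha_continuous bump_continuous)

lemma kern_continuous: "continuous_on UNIV kern"
  unfolding kern_def by (intro continuous_intros continuous_on_vec_lambda kvec_continuous)

section \<open>Trajectories and their speeds\<close>

lemma X_measurable [measurable]:
  assumes [measurable]: "f \<in> borel_measurable M" "g \<in> borel_measurable M"
  shows "(\<lambda>x. X (f x) (g x)) \<in> borel_measurable M"
  unfolding X_def by measurable

lemma V_measurable [measurable]:
  assumes [measurable]: "f \<in> borel_measurable M" "g \<in> borel_measurable M"
  shows "(\<lambda>x. V (f x) (g x)) \<in> borel_measurable M"
  unfolding V_def by measurable

lemma lines_measurable [measurable]:
  assumes [measurable]: "f \<in> borel_measurable M" "g \<in> M \<rightarrow>\<^sub>M borel \<Otimes>\<^sub>M borel"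
  shows "(\<lambda>x. lines (f x) (g x)) \<in> borel_measurable M"
  unfolding lines_def point_def by measurable

lemma lines_measurable_borel [measurable]: "lines t \<in> borel_measurable borel"
  using lines_measurable[of "\<lambda>_. t" borel id] by (simp add: borel_prod)

lemma X_continuous: "continuous_on UNIV (\<lambda>t. X t \<tau>)"
  unfolding X_def by (cases "\<tau> \<le> 1") (auto intro!: continuous_intros)

lemma V_continuous: "continuous_on UNIV (\<lambda>t. V t \<tau>)"
  unfolding V_def by (cases "\<tau> \<le> 1") (auto intro!: continuous_intros)

lemma X_bounds: "t \<in> {0..1} \<Longrightarrow> 0 \<le> \<tau> \<Longrightarrow> \<tau> \<le> 1 \<Longrightarrow> X t \<tau> \<in> {0..1}"
  by (auto simp: X_def power_le_one)

text \<open>Squaring removes the kink of the positive part at 0. Hence waiting at the origin until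
  \<open>\<tau>\<close> and then leaving is a classical trajectory.\<close>

lemma X_DERIV: "((\<lambda>t. X t \<tau>) has_real_derivative V t \<tau>) (at t)"
proof (cases "\<tau> \<le> 1")
  case True
  have "((\<lambda>s. (max 0 s)\<^sup>2) has_real_derivative 2 * max 0 s) (at s)" for s :: real
  proof (cases s "0::real" rule: linorder_cases)
    case less
    have "((\<lambda>s. 0) has_real_derivative 2 * max 0 s) (at s)" using less by simp
    then show ?thesis
      by (rule has_field_derivative_transform_within_open[of _ _ _ "{..<0}"]) (use less in auto)
  next
    case equal
    \<comment> \<open>For \<open>h \<noteq> 0\<close> the difference quotient
      \<open>(max 0 h)\<^sup>2 / h\<close> equals \<open>max 0 h\<close>.\<close>
    have "((\<lambda>h::real. max 0 h) \<longlongrightarrow> max 0 0) (at 0)" by (intro tendsto_intros)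
    then have "((\<lambda>h::real. (max 0 h)\<^sup>2 / h) \<longlongrightarrow> 0) (at 0)"
      by (rule Lim_transform_eventually[THEN tendsto_eq_rhs])
        (auto simp: max_def power2_eq_square eventually_at_filter)
    then show ?thesis using equal by (simp add: DERIV_def)
  next
    case greater
    have "((\<lambda>s. s\<^sup>2) has_real_derivative 2 * max 0 s) (at s)"
      using greater by (auto intro!: derivative_eq_intros)
    then show ?thesis
      by (rule has_field_derivative_transform_within_open[of _ _ _ "{0<..}"]) (use greater in auto)
  qed
  from DERIV_chain2[OF this, of "\<lambda>t. t - \<tau>" 1 t]
  have "((\<lambda>t. (max 0 (t - \<tau>))\<^sup>2) has_real_derivative 2 * max 0 (t - \<tau>)) (at t)"
    using DERIV_diff[OF DERIV_ident DERIV_const[of \<tau>], of t] by simp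
  then show ?thesis using True by (simp add: X_def V_def)
qed (auto simp: X_def V_def)

lemma lines_has_vector_derivative:
  "((\<lambda>t. lines t p) has_vector_derivative V t (fst p) *\<^sub>R dir) (at t within S)"
  unfolding lines_def point_def
  using has_field_derivative_at_within[OF X_DERIV[of "fst p" t], of S]
  by (auto intro!: derivative_eq_intros simp: has_real_derivative_iff_has_vector_derivative)

section \<open>Integration against the line measure\<close>

lemma strip_measurable [measurable]: "strip \<in> sets borel"
  by (intro borel_closed closed_Times) auto

lemma integral_mu:
  fixes h :: "R3 \<Rightarrow> 'b::{banach, second_countable_topology}"
  assumes [measurable]: "h \<in> borel_measurable borel"
  shows "integral\<^sup>L (mu t) h = (\<integral>p. indicator strip p *\<^sub>R h (lines t p) \<partial>lborel)"
  unfolding mu_def by (subst integral_distr) (auto simp: integral_density)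

lemma integrable_mu:
  fixes h :: "R3 \<Rightarrow> 'b::{banach, second_countable_topology}"
  assumes [measurable]: "h \<in> borel_measurable borel"
  shows "integrable (mu t) h \<longleftrightarrow> integrable lborel (\<lambda>p. indicator strip p *\<^sub>R h (lines t p))"
  unfolding mu_def by (subst integrable_distr_eq) (auto simp: integrable_density)

lemma emeasure_mu:
  assumes [measurable]: "A \<in> sets borel"
  shows "emeasure (mu t) A = emeasure lborel (strip \<inter> lines t -` A)"
proof -
  have [measurable]: "lines t -` A \<in> sets borel"
    using measurable_sets[OF lines_measurable_borel assms] by simp
  have "emeasure (mu t) A = emeasure (density lborel (\<lambda>p. ennreal (indicator strip p))) (lines t -` A)"
    unfolding mu_def by (subst emeasure_distr) auto
  also have "\<dots> = (\<integral>\<^sup>+p. indicator (strip \<inter> lines t -` A) p \<partial>lborel)"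
    by (subst emeasure_density) (auto intro!: nn_integral_cong simp del: nn_integral_indicator split: split_indicator)
  also have "\<dots> = emeasure lborel (strip \<inter> lines t -` A)"
    by (rule nn_integral_indicator) simp
  finally show ?thesis .
qed

text \<open>Turns bounded support in space into a bound on the line parameter \<open>snd p\<close>;
  as labels lie in \<open>[0, 2]\<close>, this confines integrals over the strip to a bounded
  rectangle.\<close>

lemma abs_snd_le_norm_lines: "\<bar>snd p\<bar> \<le> norm (lines t p)"
  using component_le_norm_cart[of "lines t p" 2] by (simp add: lines_def)

lemma vec_measure_mu: "vec_measure (mu t) (\<lambda>_. axis 2 1)"
proof -
  have "emeasure (mu t) C < \<infinity>" if "compact C" for C
  proof -
    obtain R where R: "\<And>x. x \<in> C \<Longrightarrow> norm x \<le> R"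
      using compact_imp_bounded[OF \<open>compact C\<close>] by (auto simp: bounded_iff)
    have [measurable]: "cbox (0::real, -R) (2::real, R) \<in> sets borel" by simp
    have "emeasure (mu t) C = emeasure lborel (strip \<inter> lines t -` C)"
      by (rule emeasure_mu) (use that in \<open>auto intro: borel_compact\<close>)
    also have "\<dots> \<le> emeasure lborel (cbox (0, -R) (2::real, R))"
    proof (rule emeasure_mono)
      show "strip \<inter> lines t -` C \<subseteq> cbox (0, -R) (2, R)"
        by (auto simp: cbox_Pair_eq abs_le_iff dest!: R dest: order_trans[OF abs_snd_le_norm_lines])
    qed simp
    also have "\<dots> < \<infinity>" using emeasure_lborel_cbox_finite by simp
    finally show ?thesis .
  qed
  then show ?thesis by (auto simp: vec_measure_def loc_finite_borel_def mu_def norm_axis_1)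
qed

section \<open>The velocity field\<close>

text \<open>The common integrability check behind the weak equations: the weight \<open>c\<close>
  will be 1 or the speed \<open>V\<close>, and \<open>H\<close> a component of a test function or of
  one of its derivatives. Vanishing for large \<open>x\<close> is enough, since times and labels are
  bounded.\<close>

lemma integrable_particles:
  fixes H :: "real \<times> R3 \<Rightarrow> real"
  assumes H: "continuous_on UNIV H" and H0: "\<And>t x. R < norm x \<Longrightarrow> H (t, x) = 0"
    and C: "\<And>x. \<bar>H x\<bar> \<le> C"
    and c [measurable]: "case_prod c \<in> borel_measurable borel"
    and B: "\<And>t \<tau>. t \<in> {0..1} \<Longrightarrow> \<tau> \<in> {0..2} \<Longrightarrow> \<bar>c t \<tau>\<bar> \<le> B"
  shows "integrable (lborel \<Otimes>\<^sub>M lborel) (\<lambda>(t, p).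
    indicator {0..1} t * (indicator strip p * (c t (fst p) * H (t, lines t p))))" (is "integrable _ ?F")
    and "t \<in> {0..1} \<Longrightarrow> integrable lborel (\<lambda>p. indicator strip p * (c t (fst p) * H (t, lines t p)))"
proof -
  note [measurable] = borel_measurable_continuous_onI[OF H, unfolded borel_prod[symmetric]]
  note c [unfolded borel_prod[symmetric], measurable]
  have B': "\<bar>indicator {0..1} t * (indicator strip p * (c t (fst p) * H (t, lines t p)))\<bar> \<le> B * C" for t p
  proof (cases "t \<in> {0..1} \<and> p \<in> strip")
    case True
    then show ?thesis using mult_mono'[OF B C, of t "fst p"] by (auto simp: abs_mult)
  next
    case False
    have "0 \<le> B * C" using order_trans[OF abs_ge_zero B, of 0 0] order_trans[OF abs_ge_zero C] by simp
    with False show ?thesis by auto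
  qed
  have supp: "indicator {0..1} t * (indicator strip p * (c t (fst p) * H (t, lines t p))) = 0"
    if "t \<notin> {0..1} \<or> fst p \<notin> {0..2} \<or> R < \<bar>snd p\<bar>" for t p
  proof (cases "R < \<bar>snd p\<bar>")
    case True
    also have "\<bar>snd p\<bar> \<le> norm (lines t p)" by (rule abs_snd_le_norm_lines)
    finally show ?thesis using H0 by simp
  next
    case False
    then show ?thesis using that by (cases p) auto
  qed
  show "integrable (lborel \<Otimes>\<^sub>M lborel) ?F"
    unfolding lborel_prod
  proof (rule integrable_lborel_bounded_support)
    show "?F \<in> borel_measurable borel" unfolding borel_prod[symmetric] by measurable
    show "bounded ({0..1::real} \<times> ({0..2::real} \<times> {-R..R}))" by (intro bounded_Times) auto
    show "?F q = 0" if "q \<notin> {0..1::real} \<times> ({0..2::real} \<times> {-R..R})" for q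
    proof -
      obtain t \<tau> y where q: "q = (t, \<tau>, y)" by (metis prod.exhaust)
      then have "t \<notin> {0..1} \<or> fst (\<tau>, y) \<notin> {0..2} \<or> R < \<bar>snd (\<tau>, y)\<bar>" using that by auto
      from supp[OF this] show ?thesis unfolding q by simp
    qed
    show "norm (?F q) \<le> B * C" for q
      unfolding split_beta real_norm_def by (rule B')
  qed
  assume t: "t \<in> {0..1}"
  show "integrable lborel (\<lambda>p. indicator strip p * (c t (fst p) * H (t, lines t p)))"
  proof (rule integrable_lborel_bounded_support)
    show "(\<lambda>p. indicator strip p * (c t (fst p) * H (t, lines t p))) \<in> borel_measurable borel"
      unfolding borel_prod[symmetric] by measurable
    show "bounded ({0..2::real} \<times> {-R..R})" by (intro bounded_Times) auto
    show "indicator strip p * (c t (fst p) * H (t, lines t p)) = 0" if "p \<notin> {0..2::real} \<times> {-R..R}" for p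
    proof -
      obtain \<tau> y where p: "p = (\<tau>, y)" by (metis prod.exhaust)
      then have "t \<notin> {0..1} \<or> fst (\<tau>, y) \<notin> {0..2} \<or> R < \<bar>snd (\<tau>, y)\<bar>" using that by auto
      from supp[OF this] show ?thesis using t unfolding p by simp
    qed
    show "norm (indicator strip p * (c t (fst p) * H (t, lines t p))) \<le> B * C" for p
      using B'[of t p] t by simp
  qed
qed

text \<open>The measure is invariant along the lines, so derivatives along them integrate to zero.\<close>
lemma integral_along_lines_eq_0:
  fixes f D :: "R3 \<Rightarrow> real"
  assumes deriv: "\<And>x h. ((\<lambda>h. f (x + h *\<^sub>R axis 2 1)) has_real_derivative D (x + h *\<^sub>R axis 2 1)) (at h)"
    and contf: "continuous_on UNIV f" and contD: "continuous_on UNIV D"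
    and f0: "\<And>x. R < norm x \<Longrightarrow> f x = 0" and D0: "\<And>x. R < norm x \<Longrightarrow> D x = 0"
    and c: "case_prod c \<in> borel_measurable borel"
    and B: "\<And>t \<tau>. t \<in> {0..1} \<Longrightarrow> \<tau> \<in> {0..2} \<Longrightarrow> \<bar>c t \<tau>\<bar> \<le> B" and t: "t \<in> {0..1}"
  shows "integrable lborel (\<lambda>p. indicator strip p * (c t (fst p) * D (lines t p)))" (is "integrable _ ?F")
    and "(\<integral>p. indicator strip p * (c t (fst p) * D (lines t p)) \<partial>lborel) = 0"
proof -
  have "D x = 0" if "x \<notin> cball 0 R" for x using that by (intro D0) simp
  from continuous_zero_outside_bounded[OF contD bounded_cball this]
  obtain C where C: "\<And>x. norm (D x) \<le> C" by blast
  have "integrable lborel (\<lambda>p. indicator strip p * (c t (fst p) * (D \<circ> snd) (t, lines t p)))"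
  proof (rule integrable_particles(2)[OF _ _ _ c B t])
    show "continuous_on UNIV (D \<circ> snd)"
      unfolding o_def by (intro continuous_on_compose2[OF contD] continuous_intros) auto
    show "R < norm x \<Longrightarrow> (D \<circ> snd) (t, x) = 0" for t :: real and x using D0 by simp
    show "\<bar>(D \<circ> snd) x\<bar> \<le> C" for x :: "real \<times> R3" using C by simp
  qed
  then show int: "integrable lborel ?F" by simp
  have inner: "(\<integral>y. D (point s y) \<partial>lborel) = 0" for s
  proof -
    have far: "R < norm (point s y)" if "y \<notin> {-R..R}" for y
    proof -
      have "R < \<bar>y\<bar>" using that by auto
      also have "\<bar>y\<bar> \<le> norm (point s y)" using component_le_norm_cart[of "point s y" 2] by simp
      finally show ?thesis .
    qed
    \<comment> \<open>The one-dimensional case along a single line, with direction 1 and constant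
      weight 1.\<close>
    have "(\<integral>y. 1 * D (point s y) \<partial>lborel) = 0"
    proof (rule integral_directional_derivative_eq_0[where v = "1::real" and f = "\<lambda>y. f (point s y)"
          and S = "{-R..R}"])
      show "((\<lambda>h. f (point s (y + h *\<^sub>R 1))) has_real_derivative D (point s (y + h *\<^sub>R 1))) (at h)" for y h
        using deriv[of "point s y" h] by (simp add: point_def algebra_simps)
      show "continuous_on UNIV (\<lambda>y. f (point s y))" "continuous_on UNIV (\<lambda>y. D (point s y))"
        unfolding point_def
        by (intro continuous_intros continuous_on_compose2[OF contf] continuous_on_compose2[OF contD]; simp)+
      show "f (point s y) = 0" "D (point s y) = 0" if "y \<notin> {-R..R}" for y
        using f0[OF far[OF that]] D0[OF far[OF that]] by simp_all
    qed auto
    then show ?thesis by simp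
  qed
  have "integral\<^sup>L lborel ?F =
      (\<integral>\<tau>. \<integral>y. indicator strip (\<tau>, y) * (c t \<tau> * D (point (X t \<tau>) y)) \<partial>lborel \<partial>lborel)"
    using lborel_pair.integral_fst'[OF int[unfolded lborel_prod[symmetric]]]
    by (simp add: lborel_prod lines_def)
  \<comment> \<open>The weight and the indicator depend on \<open>\<tau>\<close> alone and leave the
    integral along the line, which is zero by \<open>inner\<close>.\<close>
  also have "\<dots> = (\<integral>\<tau>. indicator {0..2} \<tau> * (c t \<tau> * (\<integral>y. D (point (X t \<tau>) y) \<partial>lborel)) \<partial>lborel)"
    by (simp add: indicator_times mult.assoc)
  finally show "integral\<^sup>L lborel ?F = 0" by (simp add: inner)
qed

text \<open>Self-consistency of the construction: the velocity that the lines generate is, on each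
  of them, the speed with which that line was prescribed to move.\<close>

lemma U_particle:
  assumes t: "t \<in> {0..1}" and \<tau>: "\<tau> \<in> {0..2}"
  shows "U t (X t \<tau>) = V t \<tau>"
proof -
  \<comment> \<open>Only the sources in \<open>{1<..2}\<close>, that is the immobile line, act on a
    moving line; this interval has length 1, so integrating over \<open>\<sigma>\<close> gives
    exactly \<open>V t \<tau>\<close>.\<close>
  have "indicator {0..2} \<sigma> * alpha (X t \<tau> - X t \<sigma>) = V t \<tau> * indicator {1<..2} \<sigma>" for \<sigma>
  proof (cases "\<sigma> \<in> {0..2}")
    case \<sigma>: True
    show ?thesis
    proof (cases "\<tau> \<le> 1")
      case True
      show ?thesis
      proof (cases "\<sigma> \<le> 1")
        case False
        then have "X t \<tau> - X t \<sigma> = (max 0 (t - \<tau>))\<^sup>2 - 3" using True by (simp add: X_def)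
        moreover have "alpha \<dots> = 2 * max 0 (t - \<tau>)" by (rule alpha_square) (use t \<tau> in auto)
        ultimately show ?thesis using False \<sigma> True by (simp add: V_def)
      qed (use True \<sigma> X_bounds[OF t, of \<tau>] X_bounds[OF t, of \<sigma>] \<tau> in \<open>simp add: alpha_eq_0\<close>)
    next
      case False
      then have "alpha (X t \<tau> - X t \<sigma>) = 0"
        using X_bounds[OF t, of \<sigma>] \<sigma> by (intro alpha_eq_0) (cases "\<sigma> \<le> 1"; simp add: X_def)
      then show ?thesis using False by (simp add: V_def)
    qed
  qed auto
  then show ?thesis by (simp add: U_def)
qed

text \<open>Dominated convergence with bound 2 on the labels. It asks for continuity in
  \<open>(t, r)\<close> at each fixed label only, which fits \<open>X\<close>, since
  \<open>X\<close> jumps in the label at 1.\<close>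

lemma U_continuous: "continuous_on UNIV (\<lambda>(t, r). U t r)"
proof -
  have "isCont (\<lambda>(t, r). U t r) q" for q
    unfolding continuous_at_sequentially
  proof (intro allI impI)
    fix p assume p: "p \<longlonglongrightarrow> q"
    have "(\<lambda>n. \<integral>\<tau>. indicator {0..2} \<tau> * alpha (snd (p n) - X (fst (p n)) \<tau>) \<partial>lborel)
        \<longlonglongrightarrow> (\<integral>\<tau>. indicator {0..2} \<tau> * alpha (snd q - X (fst q) \<tau>) \<partial>lborel)"
    proof (rule integral_dominated_convergence[where w = "\<lambda>\<tau>. 2 * indicator {0..2} \<tau>"])
      show "AE \<tau> in lborel. (\<lambda>n. indicator {0..2} \<tau> * alpha (snd (p n) - X (fst (p n)) \<tau>))
          \<longlonglongrightarrow> indicator {0..2} \<tau> * alpha (snd q - X (fst q) \<tau>)"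
      proof (rule AE_I2)
        fix \<tau>
        have "continuous_on UNIV (\<lambda>p. alpha (snd p - X (fst p) \<tau>))"
          by (intro alpha_continuous continuous_intros continuous_on_compose2[OF X_continuous]) auto
        then have "(\<lambda>n. alpha (snd (p n) - X (fst (p n)) \<tau>)) \<longlonglongrightarrow> alpha (snd q - X (fst q) \<tau>)"
          by (rule continuous_on_tendsto_compose[OF _ p]) auto
        then show "(\<lambda>n. indicator {0..2} \<tau> * alpha (snd (p n) - X (fst (p n)) \<tau>))
          \<longlonglongrightarrow> indicator {0..2} \<tau> * alpha (snd q - X (fst q) \<tau>)" by (intro tendsto_intros)
      qed
      show "AE \<tau> in lborel. norm (indicator {0..2} \<tau> * alpha (snd (p n) - X (fst (p n)) \<tau>))
          \<le> 2 * indicator {0..2} \<tau>" for n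
        using abs_alpha_le by (auto intro!: AE_I2 simp: indicator_def)
    qed auto
    then show "((\<lambda>(t, r). U t r) \<circ> p) \<longlonglongrightarrow> (case q of (t, r) \<Rightarrow> U t r)"
      by (simp add: U_def o_def split_beta)
  qed
  then show ?thesis by (simp add: continuous_at_imp_continuous_on)
qed

lemma U_continuous_compose:
  assumes "continuous_on S f" "continuous_on S g"
  shows "continuous_on S (\<lambda>x. U (f x) (g x))"
  using continuous_on_compose2[OF U_continuous continuous_on_Pair[OF assms]] by simp

text \<open>The cutoff \<open>bump\<close> keeps the line parameter within distance 1 of
  \<open>x $ 2\<close>, and \<open>kvec\<close> is bounded, so the integrand is bounded with bounded
  support.\<close>

lemma integrable_kvec:
  "integrable (lborel \<Otimes>\<^sub>M lborel) (\<lambda>p. indicator strip p *\<^sub>R kvec (x - lines t p))"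
  unfolding lborel_prod
proof (rule integrable_lborel_bounded_support)
  note [measurable] = borel_measurable_continuous_onI[OF kvec_continuous]
  show "(\<lambda>p. indicator strip p *\<^sub>R kvec (x - lines t p)) \<in> borel_measurable borel"
    unfolding borel_prod[symmetric] by measurable
  show "bounded ({0..2::real} \<times> {x $ 2 - 1..x $ 2 + 1})" by (intro bounded_Times) auto
  show "indicator strip p *\<^sub>R kvec (x - lines t p) = 0"
    if "p \<notin> {0..2::real} \<times> {x $ 2 - 1..x $ 2 + 1}" for p
  proof (cases "p \<in> strip")
    case True
    then have "1 < \<bar>x $ 2 - snd p\<bar>" using that by (cases p) (auto simp: abs_if)
    then show ?thesis by (simp add: kvec_def lines_def bump_eq_0)
  qed auto
  have "norm (kvec d) \<le> 4" for d
  proof -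
    have "norm (kvec d) \<le> \<bar>bump (d $ 2)\<bar> * (\<bar>alpha (d $ 3)\<bar> + \<bar>alpha (d $ 1)\<bar>)"
      unfolding kvec_def norm_scaleR
      by (intro mult_left_mono order_trans[OF norm_triangle_ineq]) (auto simp: norm_axis_1)
    also have "\<dots> \<le> 1 * (2 + 2)" by (intro mult_mono add_mono abs_bump_le abs_alpha_le) auto
    finally show ?thesis by simp
  qed
  then show "norm (indicator strip p *\<^sub>R kvec (x - lines t p)) \<le> 4" for p
    by (auto simp: indicator_def)
qed

lemma integrable_kern: "integrable (mu t) (\<lambda>y. kern (x - y) *v axis 2 1)"
proof -
  note [measurable] = borel_measurable_continuous_onI[OF kvec_continuous]
  show ?thesis
    using integrable_kvec[of x t] by (simp add: kern_mult integrable_mu lborel_prod)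
qed

text \<open>Fubini over the strip: along each line \<open>bump\<close> integrates to 1, which leaves
  the integral of \<open>alpha\<close> over the labels and no dependence on
  \<open>x $ 2\<close>.\<close>

lemma velocity_eq:
  "velocity kern mu (\<lambda>_ _. axis 2 1) t x = U t (x $ 3) *\<^sub>R axis 1 1 + U t (x $ 1) *\<^sub>R axis 3 1"
proof -
  note [measurable] = borel_measurable_continuous_onI[OF kvec_continuous]
  define a where "a \<tau> = alpha (x $ 3 - X t \<tau>) *\<^sub>R axis 1 1 + alpha (x $ 1 - X t \<tau>) *\<^sub>R (axis 3 1 :: R3)" for \<tau>
  have int: "integrable lborel (\<lambda>\<tau>. indicator {0..2} \<tau> * alpha (r - X t \<tau>))" for r
    by (rule integrable_lborel_bounded_support[where S = "{0..2}" and B = 2])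
      (use abs_alpha_le in \<open>auto simp: indicator_def\<close>)
  have "velocity kern mu (\<lambda>_ _. axis 2 1) t x = (\<integral>p. indicator strip p *\<^sub>R kvec (x - lines t p) \<partial>(lborel \<Otimes>\<^sub>M lborel))"
    by (simp add: velocity_def kern_mult integral_mu lborel_prod)
  also have "\<dots> = (\<integral>\<tau>. \<integral>y. indicator strip (\<tau>, y) *\<^sub>R kvec (x - lines t (\<tau>, y)) \<partial>lborel \<partial>lborel)"
    by (rule lborel_pair.integral_fst'[OF integrable_kvec, symmetric])
  also have "\<dots> = (\<integral>\<tau>. \<integral>y. bump (x $ 2 - y) *\<^sub>R indicator {0..2} \<tau> *\<^sub>R a \<tau> \<partial>lborel \<partial>lborel)"
    by (intro Bochner_Integration.integral_cong) (auto simp: indicator_def kvec_def lines_def a_def)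
  also have "\<dots> = (\<integral>\<tau>. indicator {0..2} \<tau> *\<^sub>R a \<tau> \<partial>lborel)"
  proof -
    have "integrable lborel (\<lambda>y. bump (x $ 2 - y))"
      \<comment> \<open>A function that is not integrable has integral 0 by convention, so the value
        1 forces integrability.\<close>
      using integral_bump[of "x $ 2"] not_integrable_integral_eq by fastforce
    then show ?thesis by (simp add: integral_bump)
  qed
  also have "\<dots> = (\<integral>\<tau>. (indicator {0..2} \<tau> * alpha (x $ 3 - X t \<tau>)) *\<^sub>R axis 1 1
      + (indicator {0..2} \<tau> * alpha (x $ 1 - X t \<tau>)) *\<^sub>R axis 3 1 \<partial>lborel)"
    by (simp add: a_def scaleR_add_right)
  also have "\<dots> = U t (x $ 3) *\<^sub>R axis 1 1 + U t (x $ 1) *\<^sub>R axis 3 1"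
    using int by (simp add: U_def)
  finally show ?thesis .
qed

lemma velocity_continuous: "continuous_on S (\<lambda>(t, x). velocity kern mu (\<lambda>_ _. axis 2 1) t x)"
  unfolding velocity_eq split_beta by (intro continuous_intros U_continuous_compose)

text \<open>On the lines the first and third coordinates agree, so the two shears have equal
  strength and the velocity points along \<open>dir\<close>.\<close>

lemma velocity_particle:
  "t \<in> {0..1} \<Longrightarrow> p \<in> strip \<Longrightarrow> velocity kern mu (\<lambda>_ _. axis 2 1) t (lines t p) = V t (fst p) *\<^sub>R dir"
  using U_particle[of t "fst p"] by (auto simp: velocity_eq lines_def dir_def scaleR_add_right)

text \<open>Each factor \<open>U t (x $ j)\<close> multiplies a derivative in a direction
  \<open>axis i 1\<close> with \<open>i \<noteq> j\<close>, along which it is constant. It is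
  therefore the invariant weight \<open>w\<close> of
  \<open>integral_directional_derivative_eq_0\<close>, for which continuity is enough.\<close>

lemma weakly_div_free_velocity: "weakly_div_free (velocity kern mu (\<lambda>_ _. axis 2 1) t)"
  unfolding weakly_div_free_def
proof (intro allI impI)
  fix \<psi> :: "R3 \<Rightarrow> real" assume \<psi>: "test_fun \<psi>"
  obtain R where R: "\<And>x. R < norm x \<Longrightarrow> \<psi> x = 0"
    "\<And>x v. R < norm x \<Longrightarrow> frechet_derivative \<psi> (at x) v = 0"
    using test_fun_bounded_support[OF \<psi>] by blast
  note contD = test_fun_derivative_continuous[OF \<psi>]
  have *: "integrable lborel (\<lambda>x. U t (x $ j) * frechet_derivative \<psi> (at x) (axis i 1)) \<and>
      (\<integral>x. U t (x $ j) * frechet_derivative \<psi> (at x) (axis i 1) \<partial>lborel) = 0"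
    if "i \<noteq> j" for i j :: 3
  proof
    have contU: "continuous_on UNIV (\<lambda>x::R3. U t (x $ j))"
      by (intro U_continuous_compose continuous_intros)
    have cont: "continuous_on UNIV (\<lambda>x. U t (x $ j) * frechet_derivative \<psi> (at x) (axis i 1))"
      by (intro continuous_intros contU contD)
    have 0: "U t (x $ j) * frechet_derivative \<psi> (at x) (axis i 1) = 0" if "x \<notin> cball 0 R" for x
      using that R(2)[of x] by simp
    obtain B where *: "\<And>x. norm (U t (x $ j) * frechet_derivative \<psi> (at x) (axis i 1)) \<le> B"
      using continuous_zero_outside_bounded[OF cont bounded_cball 0] by blast
    from integrable_lborel_bounded_support[OF borel_measurable_continuous_onI[OF cont] bounded_cball 0 *]
    show "integrable lborel (\<lambda>x. U t (x $ j) * frechet_derivative \<psi> (at x) (axis i 1))" .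
    show "(\<integral>x. U t (x $ j) * frechet_derivative \<psi> (at x) (axis i 1) \<partial>lborel) = 0"
    proof (rule integral_directional_derivative_eq_0[OF _ test_fun_continuous[OF \<psi>] contD contU bounded_cball[of 0 R]])
      show "((\<lambda>h. \<psi> (x + h *\<^sub>R axis i 1)) has_real_derivative
          frechet_derivative \<psi> (at (x + h *\<^sub>R axis i 1)) (axis i 1)) (at h)" for x h
        unfolding has_real_derivative_iff_has_vector_derivative
        by (rule test_fun_derivative_compose[OF \<psi>]) (auto intro!: derivative_eq_intros)
      show "U t ((x + h *\<^sub>R axis i 1) $ j) = U t (x $ j)" for x h
        using that by (simp add: axis_def)
    qed (use R in auto)
  qed
  have "grad3 \<psi> x \<bullet> velocity kern mu (\<lambda>_ _. axis 2 1) t x =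
      U t (x $ 3) * frechet_derivative \<psi> (at x) (axis 1 1) +
      U t (x $ 1) * frechet_derivative \<psi> (at x) (axis 3 1)" for x
    by (simp add: velocity_eq grad3_def pderiv_dir_def inner_add_right inner_axis)
  then show "integrable lborel (\<lambda>x. grad3 \<psi> x \<bullet> velocity kern mu (\<lambda>_ _. axis 2 1) t x) \<and>
      (\<integral>x. grad3 \<psi> x \<bullet> velocity kern mu (\<lambda>_ _. axis 2 1) t x \<partial>lborel) = 0"
    using *[of 1 3] *[of 3 1] by simp
qed

section \<open>Weak advection\<close>

text \<open>With the constant orientation \<open>axis 2 1\<close> the pairing integrates the
  derivative of \<open>\<psi>\<close> along the lines, hence is zero. The zero divergence is
  represented as a difference of two null measures.\<close>

lemma is_divergence_mu:
  assumes t: "t \<in> {0..1}"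
  shows "is_divergence (mu t) (\<lambda>_. axis 2 1) (null_measure borel) (null_measure borel)"
  unfolding is_divergence_def
proof (intro conjI allI impI)
  fix \<psi> :: "R3 \<Rightarrow> real" assume \<psi>: "test_fun \<psi>"
  let ?D = "\<lambda>x. frechet_derivative \<psi> (at x) (axis 2 1)"
  note contD = test_fun_derivative_continuous[OF \<psi>]
  note [measurable] = borel_measurable_continuous_onI[OF contD]
  obtain R where R: "\<And>x. R < norm x \<Longrightarrow> \<psi> x = 0"
    "\<And>x v. R < norm x \<Longrightarrow> frechet_derivative \<psi> (at x) v = 0"
    using test_fun_bounded_support[OF \<psi>] by blast
  have "(\<integral>p. indicator strip p * ((\<lambda>_ _. 1) t (fst p) * ?D (lines t p)) \<partial>lborel) = 0"
  proof (rule integral_along_lines_eq_0(2)[OF _ test_fun_continuous[OF \<psi>] contD R(1) R(2) _ _ t])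
    show "((\<lambda>h. \<psi> (x + h *\<^sub>R axis 2 1)) has_real_derivative ?D (x + h *\<^sub>R axis 2 1)) (at h)" for x h
      unfolding has_real_derivative_iff_has_vector_derivative
      by (rule test_fun_derivative_compose[OF \<psi>]) (auto intro!: derivative_eq_intros)
    show "\<bar>1\<bar> \<le> (1::real)" by simp
  qed auto
  then have "vint (mu t) (\<lambda>_. axis 2 1) (grad3 \<psi>) = 0"
    by (simp add: vint_def grad3_def pderiv_dir_def inner_axis integral_mu)
  then show "sint (null_measure borel) (null_measure borel) \<psi> = - vint (mu t) (\<lambda>_. axis 2 1) (grad3 \<psi>)"
    by (simp add: sint_def)
qed (auto simp: loc_finite_borel_def)

text \<open>The time derivative and the transport term add up to the derivative of
  \<open>\<phi>\<close> along the trajectory of each label, whose time integral gives the two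
  endpoint terms. The stretching term vanishes by integration along the lines, the last term because
  the divergence is zero.\<close>

lemma weakly_advected_mu:
  "weakly_advected 1 (velocity kern mu (\<lambda>_ _. axis 2 1)) mu (\<lambda>_ _. axis 2 1)
    (\<lambda>_. null_measure borel) (\<lambda>_. null_measure borel)"
  unfolding weakly_advected_def Let_def
proof (intro allI impI)
  fix \<phi> :: "real \<times> R3 \<Rightarrow> R3" assume \<phi>: "test_fun \<phi>"
  let ?u = "velocity kern mu (\<lambda>_ _. axis 2 1)"
  let ?g = "\<lambda>_::R3. axis 2 1 :: R3"
  define e :: R3 where "e = axis 2 1"
  define D where "D v q = frechet_derivative \<phi> (at q) v" for v q
  define A where "A t = vint (mu t) ?g (\<lambda>y. pderiv_dir \<phi> (t, y) (1, 0))" for t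
  define B where "B t = vint (mu t) ?g (\<lambda>y. pderiv_dir \<phi> (t, y) (0, ?u t y))" for t
  define C where "C t = vint (mu t) ?g (\<lambda>y. \<chi> i. pderiv_dir \<phi> (t, y) (0, axis i 1) \<bullet> ?u t y)" for t
  obtain R where R: "\<And>x. R < norm x \<Longrightarrow> \<phi> x = 0"
    "\<And>x v. R < norm x \<Longrightarrow> frechet_derivative \<phi> (at x) v = 0"
    using test_fun_bounded_support[OF \<phi>] by blast
  have far: "R < norm (t, x)" if "R < norm x" for t :: real and x :: R3
    using that norm_snd_le[of x t] by simp
  have contD: "continuous_on UNIV (D v)" for v
    unfolding D_def by (rule test_fun_derivative_continuous[OF \<phi>])
  have contu: "continuous_on S (?u t)" for S t
    unfolding velocity_eq by (intro continuous_intros U_continuous_compose)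
  have D0: "D v (t, x) = 0" if "R < norm x" for v t x using R(2)[OF far[OF that]] by (simp add: D_def)
  have bdD: "\<exists>C. \<forall>q. \<bar>D v q \<bullet> w\<bar> \<le> C" for v w
  proof -
    have c: "continuous_on UNIV (\<lambda>q. D v q \<bullet> w)" by (intro continuous_intros contD)
    have "D v q \<bullet> w = 0" if "q \<notin> cball 0 R" for q using R(2)[of q] that by (simp add: D_def)
    from continuous_zero_outside_bounded[OF c bounded_cball this] show ?thesis
      unfolding real_norm_def by blast
  qed
  have lin: "D (a, s *\<^sub>R w) q = a *\<^sub>R D (1, 0) q + s *\<^sub>R D (0, w) q" for a s w q
  proof -
    note l = test_fun_derivative_linear[OF \<phi>, of q]
    have "(a, s *\<^sub>R w) = a *\<^sub>R (1, 0) + s *\<^sub>R (0, w)" by simp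
    then show ?thesis unfolding D_def by (simp only: linear_add[OF l] linear_scale[OF l])
  qed
  have V_bound: "\<bar>V t \<tau>\<bar> \<le> 2" if "t \<in> {0..1}" "\<tau> \<in> {0..2}" for t \<tau>
    using that by (auto simp: V_def)
  have V_meas: "case_prod V \<in> borel_measurable borel"
    unfolding borel_prod[symmetric] split_beta by measurable
  \<comment> \<open>The first two terms are lifted to functions of time and label, where Fubini and
    the fundamental theorem of calculus apply. In \<open>FB\<close> the velocity is already replaced
    by its value \<open>V t (fst p) *\<^sub>R dir\<close> on the lines.\<close>
  define FA where "FA t p = indicator {0..1} t * (indicator strip p * (D (1, 0) (t, lines t p) \<bullet> e))" for t p
  define FB where "FB t p = indicator {0..1} t * (indicator strip p * (V t (fst p) * (D (0, dir) (t, lines t p) \<bullet> e)))"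
    for t p
  have intA: "integrable (lborel \<Otimes>\<^sub>M lborel) (case_prod FA)"
  proof -
    obtain K where "\<And>q. \<bar>D (1, 0) q \<bullet> e\<bar> \<le> K" using bdD by blast
    from integrable_particles(1)[of "\<lambda>q. D (1, 0) q \<bullet> e" R K "\<lambda>_ _. 1" 1, OF _ _ this]
    show ?thesis unfolding FA_def[abs_def] by (simp add: D0 contD continuous_intros)
  qed
  have intB: "integrable (lborel \<Otimes>\<^sub>M lborel) (case_prod FB)"
  proof -
    obtain K where "\<And>q. \<bar>D (0, dir) q \<bullet> e\<bar> \<le> K" using bdD by blast
    from integrable_particles(1)[of "\<lambda>q. D (0, dir) q \<bullet> e" R K V 2, OF _ _ this V_meas V_bound]
    show ?thesis unfolding FB_def[abs_def] by (simp add: D0 contD continuous_intros)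
  qed
  have measD: "(\<lambda>y. D v (t, y) \<bullet> w) \<in> borel_measurable borel" for v t w
    by (intro borel_measurable_continuous_onI continuous_intros continuous_on_compose2[OF contD]) auto
  have A: "indicator {0..1} t * A t = (\<integral>p. FA t p \<partial>lborel)" for t
    using measD[of "(1, 0)" t e] by (simp add: A_def vint_def FA_def pderiv_dir_def integral_mu D_def e_def)
  have B: "indicator {0..1} t * B t = (\<integral>p. FB t p \<partial>lborel)" for t
  proof (cases "t \<in> {0..1}")
    case True
    \<comment> \<open>Continuity of \<open>D v\<close> is known for fixed \<open>v\<close>, so the
      derivative in the varying direction \<open>?u t y\<close> is split into fixed
      directions.\<close>
    have eq: "D (0, ?u t y) (t, y) = U t (y $ 3) *\<^sub>R D (0, axis 1 1) (t, y) + U t (y $ 1) *\<^sub>R D (0, axis 3 1) (t, y)" for y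
    proof -
      note l = test_fun_derivative_linear[OF \<phi>, of "(t, y)"]
      have "(0::real, ?u t y) = U t (y $ 3) *\<^sub>R (0, axis 1 1) + U t (y $ 1) *\<^sub>R (0, axis 3 1)"
        by (simp add: velocity_eq)
      then show ?thesis unfolding D_def by (simp only: linear_add[OF l] linear_scale[OF l])
    qed
    have "continuous_on UNIV (\<lambda>y. D (0, ?u t y) (t, y) \<bullet> e)"
      unfolding eq
      by (intro continuous_intros U_continuous_compose continuous_on_compose2[OF contD]) auto
    then have m: "(\<lambda>y. D (0, ?u t y) (t, y) \<bullet> e) \<in> borel_measurable borel"
      by (rule borel_measurable_continuous_onI)
    have "B t = (\<integral>p. indicator strip p *\<^sub>R (D (0, ?u t (lines t p)) (t, lines t p) \<bullet> e) \<partial>lborel)"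
      using integral_mu[OF m, of t] by (simp add: B_def vint_def pderiv_dir_def D_def e_def)
    also have "\<dots> = (\<integral>p. FB t p \<partial>lborel)"
    proof (rule Bochner_Integration.integral_cong[OF refl])
      fix p
      show "indicator strip p *\<^sub>R (D (0, ?u t (lines t p)) (t, lines t p) \<bullet> e) = FB t p"
        using velocity_particle[OF True, of p] True lin[of 0 "V t (fst p)" dir]
        by (cases "p \<in> strip") (simp_all add: FB_def)
    qed
    finally show ?thesis using True by simp
  qed (simp add: FB_def)
  \<comment> \<open>The orientation selects the component \<open>i = 2\<close>, the derivative along
    the line. The velocity \<open>V t (fst p) *\<^sub>R dir\<close> is constant on each line, so
    what remains is the derivative of \<open>\<phi> \<bullet> dir\<close> along it.\<close>
  have C: "C t = 0" if t: "t \<in> {0..1}" for t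
  proof -
    have "continuous_on UNIV (\<lambda>y. D (0, e) (t, y) \<bullet> ?u t y)"
      by (intro continuous_intros contu continuous_on_compose2[OF contD]) auto
    then have m: "(\<lambda>y. D (0, e) (t, y) \<bullet> ?u t y) \<in> borel_measurable borel"
      by (rule borel_measurable_continuous_onI)
    have "C t = (\<integral>p. indicator strip p *\<^sub>R (D (0, e) (t, lines t p) \<bullet> ?u t (lines t p)) \<partial>lborel)"
      using integral_mu[OF m, of t]
      by (simp add: C_def vint_def pderiv_dir_def D_def e_def inner_axis)
    also have "\<dots> = (\<integral>p. indicator strip p * (V t (fst p) * (D (0, e) (t, lines t p) \<bullet> dir)) \<partial>lborel)"
    proof (rule Bochner_Integration.integral_cong[OF refl])
      fix p
      show "indicator strip p *\<^sub>R (D (0, e) (t, lines t p) \<bullet> ?u t (lines t p)) =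
          indicator strip p * (V t (fst p) * (D (0, e) (t, lines t p) \<bullet> dir))"
        using velocity_particle[OF t, of p] by (cases "p \<in> strip") simp_all
    qed
    also have "\<dots> = 0"
    proof (rule integral_along_lines_eq_0(2)[where f = "\<lambda>y. \<phi> (t, y) \<bullet> dir", OF _ _ _ _ _ V_meas V_bound t])
      show "((\<lambda>h. \<phi> (t, x + h *\<^sub>R axis 2 1) \<bullet> dir) has_real_derivative
          D (0, e) (t, x + h *\<^sub>R axis 2 1) \<bullet> dir) (at h)" for x h
      proof -
        have "((\<lambda>h. (t, x + h *\<^sub>R axis 2 1)) has_vector_derivative (0, axis 2 1)) (at h)"
          by (intro has_vector_derivative_Pair) (auto intro!: derivative_eq_intros)
        from test_fun_derivative_compose[OF \<phi> this] show ?thesis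
          unfolding has_real_derivative_iff_has_vector_derivative D_def e_def
          by (rule bounded_linear.has_vector_derivative[OF bounded_linear_inner_left])
      qed
      show "continuous_on UNIV (\<lambda>y. \<phi> (t, y) \<bullet> dir)"
        by (intro continuous_intros continuous_on_compose2[OF test_fun_continuous[OF \<phi>]]) auto
      show "continuous_on UNIV (\<lambda>y. D (0, e) (t, y) \<bullet> dir)"
        by (intro continuous_intros continuous_on_compose2[OF contD]) auto
      show "R < norm x \<Longrightarrow> \<phi> (t, x) \<bullet> dir = 0" for x using R(1)[OF far] by simp
      show "R < norm x \<Longrightarrow> D (0, e) (t, x) \<bullet> dir = 0" for x using D0 by simp
    qed
    finally show ?thesis .
  qed
  have endpoint: "vint (mu t) ?g (\<lambda>y. \<phi> (t, y)) = (\<integral>p. indicator strip p * (\<phi> (t, lines t p) \<bullet> e) \<partial>lborel)"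
    and endpoint_integrable: "t \<in> {0..1} \<Longrightarrow> integrable lborel (\<lambda>p. indicator strip p * (\<phi> (t, lines t p) \<bullet> e))" for t
  proof -
    have c: "continuous_on UNIV (\<lambda>q. \<phi> q \<bullet> e)" by (intro continuous_intros test_fun_continuous[OF \<phi>])
    have "(\<lambda>y. \<phi> (t, y) \<bullet> e) \<in> borel_measurable borel"
      by (intro borel_measurable_continuous_onI continuous_on_compose2[OF c] continuous_intros) auto
    then show "vint (mu t) ?g (\<lambda>y. \<phi> (t, y)) = (\<integral>p. indicator strip p * (\<phi> (t, lines t p) \<bullet> e) \<partial>lborel)"
      by (simp add: vint_def integral_mu e_def)
    have "\<phi> q \<bullet> e = 0" if "q \<notin> cball 0 R" for q using R(1)[of q] that by simp
    from continuous_zero_outside_bounded[OF c bounded_cball this]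
    obtain K where "\<And>q. \<bar>\<phi> q \<bullet> e\<bar> \<le> K" unfolding real_norm_def by blast
    from integrable_particles(2)[of "\<lambda>q. \<phi> q \<bullet> e" R K "\<lambda>_ _. 1" 1, OF c _ this]
    show "t \<in> {0..1} \<Longrightarrow> integrable lborel (\<lambda>p. indicator strip p * (\<phi> (t, lines t p) \<bullet> e))"
      by (simp add: R(1)[OF far])
  qed
  \<comment> \<open>The label is fixed here: on the strip and for times in \<open>{0..1}\<close>,
    the integrand is the time derivative of \<open>\<phi> (t, lines t p) \<bullet> e\<close>, by
    linearity of the derivative in its direction.\<close>
  have FTC: "(\<integral>t. FA t p + FB t p \<partial>lborel) =
      indicator strip p * (\<phi> (1, lines 1 p) \<bullet> e) - indicator strip p * (\<phi> (0, lines 0 p) \<bullet> e)" for p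
  proof -
    let ?h = "\<lambda>t. D (1, V t (fst p) *\<^sub>R dir) (t, lines t p) \<bullet> e"
    have "(\<integral>t. ?h t * indicator {0..1} t \<partial>lborel) = \<phi> (1, lines 1 p) \<bullet> e - \<phi> (0, lines 0 p) \<bullet> e"
    proof (rule integral_FTC_Icc_real)
      fix t :: real
      have "((\<lambda>t. (t, lines t p)) has_vector_derivative (1, V t (fst p) *\<^sub>R dir)) (at t)"
        by (intro has_vector_derivative_Pair lines_has_vector_derivative has_vector_derivative_id)
      from test_fun_derivative_compose[OF \<phi> this]
      show "((\<lambda>t. \<phi> (t, lines t p) \<bullet> e) has_real_derivative ?h t) (at t)"
        unfolding has_real_derivative_iff_has_vector_derivative D_def
        by (rule bounded_linear.has_vector_derivative[OF bounded_linear_inner_left])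
      have "continuous_on UNIV ?h"
        unfolding lin[of 1] lines_def point_def
        by (intro continuous_intros X_continuous V_continuous continuous_on_compose2[OF contD]) auto
      then show "isCont ?h t" by (simp add: continuous_on_eq_continuous_at)
    qed simp
    moreover have "FA t p + FB t p = indicator strip p * (?h t * indicator {0..1} t)" for t
      by (simp add: FA_def FB_def lin[of 1] inner_add_left algebra_simps)
    ultimately show ?thesis by (simp add: right_diff_distrib)
  qed
  have sum: "(LINT t:{0..1}|lborel. A t) + (LINT t:{0..1}|lborel. B t) =
      vint (mu 1) ?g (\<lambda>y. \<phi> (1, y)) - vint (mu 0) ?g (\<lambda>y. \<phi> (0, y))"
  proof -
    have "(LINT t:{0..1}|lborel. A t) + (LINT t:{0..1}|lborel. B t) =
        (\<integral>t. \<integral>p. FA t p \<partial>lborel \<partial>lborel) + (\<integral>t. \<integral>p. FB t p \<partial>lborel \<partial>lborel)"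
      by (simp add: set_lebesgue_integral_def A B)
    also have "\<dots> = integral\<^sup>L (lborel \<Otimes>\<^sub>M lborel) (case_prod FA) + integral\<^sup>L (lborel \<Otimes>\<^sub>M lborel) (case_prod FB)"
      using lborel_pair.integral_fst[OF intA] lborel_pair.integral_fst[OF intB] by simp
    also have "\<dots> = integral\<^sup>L (lborel \<Otimes>\<^sub>M lborel) (\<lambda>q. case_prod FA q + case_prod FB q)"
      by (rule Bochner_Integration.integral_add[OF intA intB, symmetric])
    \<comment> \<open>The order is exchanged so that time is integrated first, label by
      label.\<close>
    also have "\<dots> = (\<integral>p. \<integral>t. FA t p + FB t p \<partial>lborel \<partial>lborel)"
    proof -
      have "integrable (lborel \<Otimes>\<^sub>M lborel) (\<lambda>(t, p). FA t p + FB t p)"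
        using Bochner_Integration.integrable_add[OF intA intB] by (simp add: split_beta')
      from lborel_pair.integral_snd[OF this] show ?thesis by (simp add: split_beta')
    qed
    also have "\<dots> = vint (mu 1) ?g (\<lambda>y. \<phi> (1, y)) - vint (mu 0) ?g (\<lambda>y. \<phi> (0, y))"
      unfolding FTC endpoint by (rule Bochner_Integration.integral_diff) (simp_all add: endpoint_integrable)
    finally show ?thesis .
  qed
  have C0: "(\<lambda>t. indicator {0..1} t *\<^sub>R C t) = (\<lambda>_. 0)" using C by (auto simp: indicator_def)
  have iA: "set_integrable lborel {0..1} A"
    using lborel_pair.integrable_fst[OF intA] by (simp add: set_integrable_def A)
  have iB: "set_integrable lborel {0..1} B"
    using lborel_pair.integrable_fst[OF intB] by (simp add: set_integrable_def B)
  have iC: "set_integrable lborel {0..1} C" "(LINT t:{0..1}|lborel. C t) = 0"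
    unfolding set_integrable_def set_lebesgue_integral_def C0 by simp_all
  show "set_integrable lborel {0..1} (\<lambda>t. vint (mu t) ?g (\<lambda>y. pderiv_dir \<phi> (t, y) (1, 0))) \<and>
    set_integrable lborel {0..1} (\<lambda>t. vint (mu t) ?g (\<lambda>y. pderiv_dir \<phi> (t, y) (0, ?u t y))) \<and>
    set_integrable lborel {0..1} (\<lambda>t. vint (mu t) ?g (\<lambda>y. \<chi> i. pderiv_dir \<phi> (t, y) (0, axis i 1) \<bullet> ?u t y)) \<and>
    set_integrable lborel {0..1} (\<lambda>t. sint (null_measure borel) (null_measure borel) (\<lambda>y. \<phi> (t, y) \<bullet> ?u t y)) \<and>
    (LINT t:{0..1}|lborel. vint (mu t) ?g (\<lambda>y. pderiv_dir \<phi> (t, y) (1, 0)))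
      - vint (mu 1) ?g (\<lambda>y. \<phi> (1, y)) + vint (mu 0) ?g (\<lambda>y. \<phi> (0, y))
      + (LINT t:{0..1}|lborel. vint (mu t) ?g (\<lambda>y. pderiv_dir \<phi> (t, y) (0, ?u t y)))
      - (LINT t:{0..1}|lborel. vint (mu t) ?g (\<lambda>y. \<chi> i. pderiv_dir \<phi> (t, y) (0, axis i 1) \<bullet> ?u t y))
      - (LINT t:{0..1}|lborel. sint (null_measure borel) (null_measure borel) (\<lambda>y. \<phi> (t, y) \<bullet> ?u t y)) = 0"
    unfolding A_def[symmetric] B_def[symmetric] C_def[symmetric]
    using iA iB iC sum by (simp add: sint_def set_integrable_def set_lebesgue_integral_def)
qed

section \<open>Dimensions of the supports\<close>

lemma emeasure_lborel_open_neq_0: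
  fixes S :: "'a::euclidean_space set"
  assumes "open S" "S \<noteq> {}"
  shows "emeasure lborel S \<noteq> 0"
proof
  assume "emeasure lborel S = 0"
  then have "S \<in> null_sets lborel" using assms(1) by (auto simp: null_sets_def)
  then have "negligible S" using null_sets_completionI by (auto simp: negligible_iff_null_sets)
  then show False using open_not_negligible[OF assms] by simp
qed

lemma msupp_mu_subset:
  assumes F: "closed F" and p: "\<And>p. p \<in> strip \<Longrightarrow> lines t p \<in> F"
  shows "msupp (mu t) \<subseteq> F"
proof
  fix x assume x: "x \<in> msupp (mu t)"
  show "x \<in> F"
  proof (rule ccontr)
    assume "x \<notin> F"
    then obtain e where e: "0 < e" "ball x e \<subseteq> - F"
      using open_contains_ball[of "- F"] F by (auto simp: open_Compl)
    then have "strip \<inter> lines t -` ball x e = {}" using p by blast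
    then have "emeasure (mu t) (ball x e) = 0" by (simp add: emeasure_mu)
    then show False using x e(1) by (auto simp: msupp_def)
  qed
qed

text \<open>Over the open label set \<open>0 < \<tau> < 1\<close>, which avoids the jump of
  \<open>X\<close> at 1, the map \<open>lines t\<close> is continuous. The preimage of a ball around
  one of its values is then open and nonempty, so it has positive Lebesgue measure.\<close>

lemma lines_in_msupp:
  assumes "0 < \<tau>" "\<tau> < 1"
  shows "lines t (\<tau>, y) \<in> msupp (mu t)"
  unfolding msupp_def
proof (intro CollectI allI impI)
  fix e :: real assume e: "0 < e"
  let ?O = "{0<..<1::real} \<times> (UNIV :: real set)"
  let ?S = "?O \<inter> lines t -` ball (lines t (\<tau>, y)) e"
  have "continuous_on ?O (\<lambda>p. point ((max 0 (t - fst p))\<^sup>2) (snd p))"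
    unfolding point_def by (intro continuous_intros)
  then have "continuous_on ?O (lines t)"
    by (rule continuous_on_eq) (auto simp: lines_def X_def)
  then have "open ?S" by (rule continuous_open_preimage) (auto intro: open_Times)
  moreover have "(\<tau>, y) \<in> ?S" using assms e by simp
  ultimately have "emeasure lborel ?S \<noteq> 0" by (metis emeasure_lborel_open_neq_0 empty_iff)
  moreover have "emeasure lborel ?S \<le> emeasure lborel (strip \<inter> lines t -` ball (lines t (\<tau>, y)) e)"
  proof (rule emeasure_mono)
    show "strip \<inter> lines t -` ball (lines t (\<tau>, y)) e \<in> sets lborel"
      using measurable_sets[OF lines_measurable_borel, of "ball (lines t (\<tau>, y)) e" t] by simp
  qed auto
  ultimately show "emeasure (mu t) (ball (lines t (\<tau>, y)) e) \<noteq> 0"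
    by (auto simp: emeasure_mu)
qed

section \<open>Coverings by small cells\<close>

lemma unit_interval_subdivision:
  assumes "a \<le> x" "x \<le> a + 1" "0 < N"
  obtains i where "i < N" "x \<in> {a + real i / real N..a + real (Suc i) / real N}"
proof (cases "x = a + 1")
  \<comment> \<open>The right endpoint goes into the last cell; the floor used below would give the
    index \<open>N\<close> here.\<close>
  case True
  with assms show thesis by (intro that[of "N - 1"]) (auto simp: field_simps of_nat_diff)
next
  case False
  define i where "i = nat \<lfloor>(x - a) * real N\<rfloor>"
  have 0: "0 \<le> (x - a) * real N" using assms by simp
  have "(x - a) * real N < real N" using assms False by simp
  then have "i < N" unfolding i_def using 0 by linarith
  moreover have "real i \<le> (x - a) * real N" "(x - a) * real N \<le> real (Suc i)"
    unfolding i_def using 0 by linarith+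
  ultimately show thesis using assms by (intro that[of i]) (auto simp: field_simps)
qed

lemma dist_point_le: "dist (point s y) (point s' y') \<le> norm dir * \<bar>s - s'\<bar> + \<bar>y - y'\<bar>"
proof -
  have "point s y - point s' y' = (s - s') *\<^sub>R dir + (y - y') *\<^sub>R axis 2 1"
    by (simp add: point_def algebra_simps)
  then show ?thesis
    using norm_triangle_ineq[of "(s - s') *\<^sub>R dir" "(y - y') *\<^sub>R axis 2 1"]
    by (simp add: dist_norm norm_axis_1 mult.commute)
qed

lemma bounded_point_image:
  assumes "bounded S"
  shows "bounded ((\<lambda>(s, y). point s y) ` S)"
proof -
  have "bounded_linear (\<lambda>p. fst p *\<^sub>R dir + snd p *\<^sub>R axis 2 1)"
    by (intro bounded_linear_add bounded_linear_compose[OF bounded_linear_scaleR_left]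
        bounded_linear_fst bounded_linear_snd)
  from bounded_linear_image[OF assms this] show ?thesis
    by (simp add: point_def split_beta)
qed

lemma hausdorff_measure_line_eq_0:
  assumes "1 < s"
  shows "hausdorff_measure s (point b ` {a..a + 1}) = 0"
\<comment> \<open>Each segment is written as the image of a degenerate rectangle, so that
  \<open>bounded_point_image\<close> applies.\<close>
proof (rule hausdorff_measure_eq_0_of_covers[where n = 1 and c = 1
      and C = "\<lambda>N i. (\<lambda>(s, y). point s y) ` ({b} \<times> {a + real i / real N..a + real (Suc i) / real N})"])
  show "point b ` {a..a + 1} \<subseteq> (\<Union>i<N ^ 1. (\<lambda>(s, y). point s y) `
      ({b} \<times> {a + real i / real N..a + real (Suc i) / real N}))" if "0 < N" for N
  proof (rule image_subsetI)
    fix y assume "y \<in> {a..a + 1}"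
    then have y: "a \<le> y" "y \<le> a + 1" by auto
    obtain i where "i < N" "y \<in> {a + real i / real N..a + real (Suc i) / real N}"
      by (rule unit_interval_subdivision[OF y \<open>0 < N\<close>])
    then show "point b y \<in> (\<Union>i<N ^ 1. (\<lambda>(s, y). point s y) `
      ({b} \<times> {a + real i / real N..a + real (Suc i) / real N}))" by fastforce
  qed
  show "diameter ((\<lambda>(s, y). point s y) ` ({b} \<times> {a + real i / real N..a + real (Suc i) / real N}))
      \<le> 1 / real N" for N i
  proof (rule diameter_le)
    fix v w
    assume "v \<in> (\<lambda>(s, y). point s y) ` ({b} \<times> {a + real i / real N..a + real (Suc i) / real N})"
      and "w \<in> (\<lambda>(s, y). point s y) ` ({b} \<times> {a + real i / real N..a + real (Suc i) / real N})"
    then obtain y y' where vw: "v = point b y" "w = point b y'"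
      "y \<in> {a + real i / real N..a + real (Suc i) / real N}" "y' \<in> {a + real i / real N..a + real (Suc i) / real N}"
      by auto
    then have "\<bar>y - y'\<bar> \<le> 1 / real N" by (auto simp: add_divide_distrib abs_le_iff)
    then show "norm (v - w) \<le> 1 / real N"
      using dist_point_le[of b y b y'] vw by (simp add: dist_norm)
  qed simp
qed (use assms in \<open>auto intro!: bounded_point_image bounded_Times\<close>)

lemma hausdorff_measure_square_eq_0:
  assumes "2 < s"
  shows "hausdorff_measure s ((\<lambda>(s, y). point s y) ` ({a..a + 1} \<times> {b..b + 1})) = 0"
proof -
  define I where "I c N i = {c + real i / real N..c + real (Suc i) / real N}" for c N i
  \<comment> \<open>One index below \<open>N ^ 2\<close> encodes the row and the column of a cell by
    \<open>div\<close> and \<open>mod\<close>.\<close>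
  let ?C = "\<lambda>N i. (\<lambda>(s, y). point s y) ` (I a N (i div N) \<times> I b N (i mod N))"
  have len: "\<bar>x - y\<bar> \<le> 1 / real N" if "x \<in> I c N i" "y \<in> I c N i" for x y c N i
    using that by (auto simp: I_def add_divide_distrib abs_le_iff)
  show ?thesis
  proof (rule hausdorff_measure_eq_0_of_covers[where n = 2 and c = "norm dir + 1" and C = ?C])
    show "(\<lambda>(s, y). point s y) ` ({a..a + 1} \<times> {b..b + 1}) \<subseteq> (\<Union>i<N ^ 2. ?C N i)" if N: "0 < N" for N
    proof safe
      fix s y assume s: "s \<in> {a..a + 1}" and y: "y \<in> {b..b + 1}"
      obtain i where i: "i < N" "s \<in> I a N i"
        using unit_interval_subdivision[of a s N] s N unfolding I_def by auto
      obtain j where j: "j < N" "y \<in> I b N j"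
        using unit_interval_subdivision[of b y N] y N unfolding I_def by auto
      have "i * N + j < N ^ 2"
      proof -
        have "i * N + j < Suc i * N" using j by simp
        also have "\<dots> \<le> N * N" using i by (intro mult_le_mono1) simp
        finally show ?thesis by (simp add: power2_eq_square)
      qed
      moreover have "point s y \<in> ?C N (i * N + j)" using i j by auto
      ultimately show "point s y \<in> (\<Union>i<N ^ 2. ?C N i)" by blast
    qed
    show "diameter (?C N i) \<le> (norm dir + 1) / real N" for N i
    proof (rule diameter_le)
      fix v w assume "v \<in> ?C N i" "w \<in> ?C N i"
      then obtain s y s' y' where vw: "v = point s y" "w = point s' y'"
        "s \<in> I a N (i div N)" "s' \<in> I a N (i div N)" "y \<in> I b N (i mod N)" "y' \<in> I b N (i mod N)"
        by auto
      have "norm (v - w) \<le> norm dir * \<bar>s - s'\<bar> + \<bar>y - y'\<bar>"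
        using dist_point_le[of s y s' y'] vw by (simp add: dist_norm)
      also have "\<dots> \<le> norm dir * (1 / real N) + 1 / real N"
        using len vw by (intro add_mono mult_left_mono) auto
      finally show "norm (v - w) \<le> (norm dir + 1) / real N" by (simp add: add_divide_distrib)
    qed simp
    show "bounded (?C N i)" for N i
      unfolding I_def by (intro bounded_point_image bounded_Times) auto
  qed (use assms in auto)
qed

text \<open>At time 0 all labels in \<open>[0, 1]\<close> sit at the origin, so the support lies on
  two lines, which countably many unit segments cover. Projection to the second coordinate does not
  increase distances and gives the lower bound.\<close>

lemma hausdorff_dim_msupp_mu_0: "hausdorff_dim (msupp (mu 0)) = 1"
proof (rule hausdorff_dim_eqI)
  fix s :: real assume s: "1 < s"
  define A where "A n = (case from_nat n of (b, l) \<Rightarrow>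
    point (if b then 0 else 3) ` {real_of_int l..real_of_int l + 1})" for n
  have "closed (range (point b))" for b
  proof -
    have "range (point b) = {x. x $ 1 = b} \<inter> {x. x $ 3 = b}"
      by (auto simp: image_iff vec_eq_iff forall_3)
    then show ?thesis by (simp add: closed_Int closed_Collect_eq continuous_intros)
  qed
  then have "msupp (mu 0) \<subseteq> range (point 0) \<union> range (point 3)"
    by (intro msupp_mu_subset closed_Un) (auto simp: lines_def X_def)
  also have "\<dots> \<subseteq> (\<Union>n. A n)"
  proof -
    have "point (if b then 0 else 3) y \<in> A (to_nat (b, \<lfloor>y\<rfloor>))" for b y
      using real_of_int_floor_add_one_ge[of y] by (auto simp: A_def)
    from this[of True] this[of False] show ?thesis by auto
  qed
  finally show "hausdorff_measure s (msupp (mu 0)) = 0"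
    by (rule hausdorff_measure_countable_Union_eq_0[rotated])
      (simp add: A_def hausdorff_measure_line_eq_0 s split: prod.split)
next
  fix s :: real assume s: "0 \<le> s" "s < 1"
  \<comment> \<open>Any label strictly between 0 and 1 would serve as well as 1/2.\<close>
  have "point 0 y \<in> msupp (mu 0)" for y
    using lines_in_msupp[of "1/2" 0 y] by (simp add: lines_def X_def)
  then have "box 0 One \<subseteq> (\<lambda>v. v $ 2) ` msupp (mu 0)"
    by (metis point_nth(2) image_eqI subsetI)
  then show "hausdorff_measure s (msupp (mu 0)) \<noteq> 0"
    by (rule hausdorff_measure_neq_0[rotated]) (use s in \<open>auto simp: dist_vec_nth_le\<close>)
qed simp

text \<open>The support lies in the plane where the first and third coordinates agree, which
  countably many squares cover. The projection to the first two coordinates does not increase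
  distances, and by time 1 the image of the support contains the open unit square.\<close>

lemma hausdorff_dim_msupp_mu_1: "hausdorff_dim (msupp (mu 1)) = 2"
proof (rule hausdorff_dim_eqI)
  fix s :: real assume s: "2 < s"
  define A where "A n = (case from_nat n of (k, l) \<Rightarrow> (\<lambda>(s, y). point s y) `
    ({real_of_int k..real_of_int k + 1} \<times> {real_of_int l..real_of_int l + 1}))" for n
  have "closed {x::R3. x $ 1 = x $ 3}" by (intro closed_Collect_eq continuous_intros)
  then have "msupp (mu 1) \<subseteq> {x. x $ 1 = x $ 3}"
    by (rule msupp_mu_subset) (simp add: lines_def)
  also have "\<dots> \<subseteq> (\<Union>n. A n)"
  proof
    fix x :: R3 assume "x \<in> {x. x $ 1 = x $ 3}"
    then have "x = point (x $ 1) (x $ 2)" by (simp add: vec_eq_iff forall_3)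
    moreover have "(x $ 1, x $ 2) \<in> {real_of_int \<lfloor>x $ 1\<rfloor>..real_of_int \<lfloor>x $ 1\<rfloor> + 1} \<times>
        {real_of_int \<lfloor>x $ 2\<rfloor>..real_of_int \<lfloor>x $ 2\<rfloor> + 1}"
      using real_of_int_floor_add_one_ge by simp
    ultimately have "x \<in> A (to_nat (\<lfloor>x $ 1\<rfloor>, \<lfloor>x $ 2\<rfloor>))"
      unfolding A_def by (simp only: from_nat_to_nat split) (metis (no_types, lifting) case_prod_conv image_eqI)
    then show "x \<in> (\<Union>n. A n)" by blast
  qed
  finally show "hausdorff_measure s (msupp (mu 1)) = 0"
    by (rule hausdorff_measure_countable_Union_eq_0[rotated])
      (simp add: A_def hausdorff_measure_square_eq_0 s split: prod.split)
next
  fix s :: real assume s: "0 \<le> s" "s < 2"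
  have "(a, b) \<in> (\<lambda>v. (v $ 1, v $ 2)) ` msupp (mu 1)" if "0 < a" "a < 1" for a b
  proof -
    \<comment> \<open>The line found at position \<open>a\<close> at time 1 is the one that left at
      \<open>\<tau> = 1 - sqrt a\<close>.\<close>
    have "lines 1 (1 - sqrt a, b) \<in> msupp (mu 1)"
      using that by (intro lines_in_msupp) auto
    moreover have "lines 1 (1 - sqrt a, b) = point a b"
      using that by (simp add: lines_def X_def)
    ultimately show ?thesis by (force intro: rev_image_eqI)
  qed
  then have "box 0 One \<subseteq> (\<lambda>v. (v $ 1, v $ 2)) ` msupp (mu 1)"
    using inner_sum_left_Basis[of "(1, 0) :: real \<times> real"] inner_sum_left_Basis[of "(0, 1) :: real \<times> real"]
    by (auto simp: mem_box Basis_prod_def)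
  then show "hausdorff_measure s (msupp (mu 1)) \<noteq> 0"
  proof (rule hausdorff_measure_neq_0[rotated])
    show "dist (x $ 1, x $ 2) (y $ 1, y $ 2) \<le> dist x y" for x y :: R3
      by (simp add: dist_Pair_Pair dist_vec_def L2_set_def sum_3)
  qed (use s in auto)
qed simp

theorem theorem4:
  shows "\<exists>(K :: R3 \<Rightarrow> real^3^3) (T :: real) (\<mu> :: real \<Rightarrow> R3 measure) (g :: real \<Rightarrow> R3 \<Rightarrow> R3)
            (np :: real \<Rightarrow> R3 measure) (nm :: real \<Rightarrow> R3 measure).
     continuous_on UNIV K \<and> T > 0 \<and>
     (\<forall>t\<in>{0..T}. vec_measure (\<mu> t) (g t) \<and> is_divergence (\<mu> t) (g t) (np t) (nm t)) \<and>
     (\<forall>t\<in>{0..T}. \<forall>x. integrable (\<mu> t) (\<lambda>y. K (x - y) *v g t y)) \<and>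
     continuous_on ({0..T} \<times> UNIV) (\<lambda>(t, x). velocity K \<mu> g t x) \<and>
     (\<forall>t\<in>{0..T}. weakly_div_free (velocity K \<mu> g t)) \<and>
     weakly_advected T (velocity K \<mu> g) \<mu> g np nm \<and>
     hausdorff_dim (msupp (\<mu> 0)) = 1 \<and>
     hausdorff_dim (msupp (\<mu> T)) = 2"
\<comment> \<open>The goals below fix the witnesses: \<open>kern\<close>, final time 1, which is the
  end of the departure interval, \<open>mu\<close>, the constant orientation
  \<open>axis 2 1\<close>, and null measures for both parts of the divergence.\<close>
proof (intro exI conjI ballI allI)
  show "continuous_on UNIV kern" by (rule kern_continuous)
  show "(0::real) < 1" by simp
  show "vec_measure (mu t) (\<lambda>_. axis 2 1)" for t by (rule vec_measure_mu)
  show "is_divergence (mu t) (\<lambda>_. axis 2 1) (null_measure borel) (null_measure borel)"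
    if "t \<in> {0..1}" for t using that by (rule is_divergence_mu)
  show "integrable (mu t) (\<lambda>y. kern (x - y) *v axis 2 1)" for t x by (rule integrable_kern)
  show "continuous_on ({0..1} \<times> UNIV) (\<lambda>(t, x). velocity kern mu (\<lambda>_ _. axis 2 1) t x)"
    by (rule velocity_continuous)
  show "weakly_div_free (velocity kern mu (\<lambda>_ _. axis 2 1) t)" for t
    by (rule weakly_div_free_velocity)
  show "weakly_advected 1 (velocity kern mu (\<lambda>_ _. axis 2 1)) mu (\<lambda>_ _. axis 2 1)
    (\<lambda>_. null_measure borel) (\<lambda>_. null_measure borel)" by (rule weakly_advected_mu)
qed (rule hausdorff_dim_msupp_mu_0 hausdorff_dim_msupp_mu_1)+

end
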